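(* The following are equivalent: (a) the continuum hypothesis, $2^{\aleph_0} = \aleph_1$; (b) (Keisler's criterion) if $\mathcal{L}$ is a countable first-order language and $\mathbf{M}, \mathbf{N}$ are $\mathcal{L}$-structures of size $\leq 2^{\aleph_0}$, then $\mathbf{M} \equiv \mathbf{N}$ if and only if there exists an ultrafilter $\mathcal{U}$ on $\omega$ such that $\mathbf{M}^{\omega}/\mathcal{U} \simeq \mathbf{N}^{\omega}/\mathcal{U}$.
   Context: The ambient theory is ZFC. The size of a structure is the cardinality of its universe. $\mathbf{M} \equiv \mathbf{N}$ denotes elementary equivalence, $\mathbf{M}^{\omega}/\mathcal{U}$ denotes the ultrapower of $\mathbf{M}$ by the ultrafilter $\mathcal{U}$ on $\omega$, and $\simeq$ denotes isomorphism of structures. *)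

theory Defs
  imports Complex_Main "HOL-Library.Countable_Set"
begin

unbundle cardinal_syntax

text \<open>First-order logic with equality; constants are function symbols of arity 0.\<close>

record ('f, 'r) language =
  Funs :: "'f set"
  Rels :: "'r set"
  fun_arity :: "'f \<Rightarrow> nat"
  rel_arity :: "'r \<Rightarrow> nat"

definition countable_language :: "('f, 'r) language \<Rightarrow> bool" where
  "countable_language L \<longleftrightarrow> countable (Funs L) \<and> countable (Rels L)"

datatype 'f trm = Var nat | Fn 'f "'f trm list"

datatype ('f, 'r) form =
    Falsum
  | Eql "'f trm" "'f trm"
  | Rel 'r "'f trm list"
  | Imp "('f, 'r) form" "('f, 'r) form"
  | All nat "('f, 'r) form"

fun trm_of :: "('f, 'r) language \<Rightarrow> 'f trm \<Rightarrow> bool" where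
  "trm_of L (Var x) \<longleftrightarrow> True"
| "trm_of L (Fn f ts) \<longleftrightarrow>
     f \<in> Funs L \<and> length ts = fun_arity L f \<and> (\<forall>t \<in> set ts. trm_of L t)"

fun form_of :: "('f, 'r) language \<Rightarrow> ('f, 'r) form \<Rightarrow> bool" where
  "form_of L Falsum \<longleftrightarrow> True"
| "form_of L (Eql s t) \<longleftrightarrow> trm_of L s \<and> trm_of L t"
| "form_of L (Rel r ts) \<longleftrightarrow>
     r \<in> Rels L \<and> length ts = rel_arity L r \<and> (\<forall>t \<in> set ts. trm_of L t)"
| "form_of L (Imp p q) \<longleftrightarrow> form_of L p \<and> form_of L q"
| "form_of L (All x p) \<longleftrightarrow> form_of L p"

fun vars_trm :: "'f trm \<Rightarrow> nat set" where
  "vars_trm (Var x) = {x}"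
| "vars_trm (Fn f ts) = (\<Union>t \<in> set ts. vars_trm t)"

fun free_vars :: "('f, 'r) form \<Rightarrow> nat set" where
  "free_vars Falsum = {}"
| "free_vars (Eql s t) = vars_trm s \<union> vars_trm t"
| "free_vars (Rel r ts) = (\<Union>t \<in> set ts. vars_trm t)"
| "free_vars (Imp p q) = free_vars p \<union> free_vars q"
| "free_vars (All x p) = free_vars p - {x}"

definition sentence_of :: "('f, 'r) language \<Rightarrow> ('f, 'r) form \<Rightarrow> bool" where
  "sentence_of L p \<longleftrightarrow> form_of L p \<and> free_vars p = {}"

text \<open>
  The interpretations are total functions on lists; only their values at symbols of the language
  and at lists over the universe of the right length carry meaning.
\<close>

record ('f, 'r, 'a) struct =
  universe :: "'a set"
  fun_int :: "'f \<Rightarrow> 'a list \<Rightarrow> 'a"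
  rel_int :: "'r \<Rightarrow> 'a list \<Rightarrow> bool"

definition args :: "'a set \<Rightarrow> nat \<Rightarrow> 'a list set" where
  "args A n = {xs. set xs \<subseteq> A \<and> length xs = n}"

definition structure_of :: "('f, 'r) language \<Rightarrow> ('f, 'r, 'a) struct \<Rightarrow> bool" where
  "structure_of L M \<longleftrightarrow>
     universe M \<noteq> {} \<and>
     (\<forall>f \<in> Funs L. \<forall>xs \<in> args (universe M) (fun_arity L f). fun_int M f xs \<in> universe M)"

fun eval_trm :: "('f, 'r, 'a) struct \<Rightarrow> (nat \<Rightarrow> 'a) \<Rightarrow> 'f trm \<Rightarrow> 'a" where
  "eval_trm M v (Var x) = v x"
| "eval_trm M v (Fn f ts) = fun_int M f (map (eval_trm M v) ts)"

fun sat :: "('f, 'r, 'a) struct \<Rightarrow> (nat \<Rightarrow> 'a) \<Rightarrow> ('f, 'r) form \<Rightarrow> bool" where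
  "sat M v Falsum \<longleftrightarrow> False"
| "sat M v (Eql s t) \<longleftrightarrow> eval_trm M v s = eval_trm M v t"
| "sat M v (Rel r ts) \<longleftrightarrow> rel_int M r (map (eval_trm M v) ts)"
| "sat M v (Imp p q) \<longleftrightarrow> (sat M v p \<longrightarrow> sat M v q)"
| "sat M v (All x p) \<longleftrightarrow> (\<forall>a \<in> universe M. sat M (v(x := a)) p)"

definition models :: "('f, 'r, 'a) struct \<Rightarrow> ('f, 'r) form \<Rightarrow> bool" where
  "models M p \<longleftrightarrow> (\<forall>v. range v \<subseteq> universe M \<longrightarrow> sat M v p)"

definition elementarily_equivalent ::
    "('f, 'r) language \<Rightarrow> ('f, 'r, 'a) struct \<Rightarrow> ('f, 'r, 'b) struct \<Rightarrow> bool" where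
  "elementarily_equivalent L M N \<longleftrightarrow> (\<forall>p. sentence_of L p \<longrightarrow> (models M p \<longleftrightarrow> models N p))"

definition isomorphic ::
    "('f, 'r) language \<Rightarrow> ('f, 'r, 'a) struct \<Rightarrow> ('f, 'r, 'b) struct \<Rightarrow> bool" where
  "isomorphic L M N \<longleftrightarrow>
     (\<exists>h. bij_betw h (universe M) (universe N) \<and>
       (\<forall>f \<in> Funs L. \<forall>xs \<in> args (universe M) (fun_arity L f).
          h (fun_int M f xs) = fun_int N f (map h xs)) \<and>
       (\<forall>r \<in> Rels L. \<forall>xs \<in> args (universe M) (rel_arity L r).
          rel_int M r xs \<longleftrightarrow> rel_int N r (map h xs)))"

text \<open>Principal ultrafilters are included.\<close>

definition ultrafilter :: "'i filter \<Rightarrow> bool" where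
  "ultrafilter U \<longleftrightarrow>
     U \<noteq> bot \<and> (\<forall>P. eventually P U \<or> eventually (\<lambda>i. \<not> P i) U)"

definition eq_mod :: "'i filter \<Rightarrow> 'a set \<Rightarrow> (('i \<Rightarrow> 'a) \<times> ('i \<Rightarrow> 'a)) set" where
  "eq_mod U A =
     {(g, h). range g \<subseteq> A \<and> range h \<subseteq> A \<and> eventually (\<lambda>i. g i = h i) U}"

text \<open>
  The elements of the ultrapower are equivalence classes of functions. Below, \<open>gs\<close> is a list of
  representatives of the list \<open>Xs\<close> of classes; the choice does not matter
  (\<open>fun_int_ultrapower\<close> and \<open>rel_int_ultrapower\<close>).
\<close>

definition ultrapower ::
    "('f, 'r, 'a) struct \<Rightarrow> 'i filter \<Rightarrow> ('f, 'r, ('i \<Rightarrow> 'a) set) struct" where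
  "ultrapower M U =
     \<lparr>universe = {g. range g \<subseteq> universe M} // eq_mod U (universe M),
      fun_int = (\<lambda>f Xs. let gs = map (\<lambda>X. SOME g. g \<in> X) Xs in
         eq_mod U (universe M) `` {\<lambda>i. fun_int M f (map (\<lambda>g. g i) gs)}),
      rel_int = (\<lambda>r Xs. let gs = map (\<lambda>X. SOME g. g \<in> X) Xs in
         eventually (\<lambda>i. rel_int M r (map (\<lambda>g. g i) gs)) U)\<rparr>"

lemma equiv_eq_mod: "equiv {g. range g \<subseteq> A} (eq_mod U A)"
proof (rule equivI)
  show "eq_mod U A \<subseteq> {g. range g \<subseteq> A} \<times> {g. range g \<subseteq> A}"
    by (auto simp: eq_mod_def)
  show "refl_on {g. range g \<subseteq> A} (eq_mod U A)"
    by (auto simp: refl_on_def eq_mod_def)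
  show "sym (eq_mod U A)"
    by (auto simp: sym_def eq_mod_def eq_commute)
  show "trans (eq_mod U A)"
    by (auto simp: trans_def eq_mod_def elim: eventually_elim2)
qed

lemma eventually_representatives:
  assumes "\<forall>g \<in> set gs. range g \<subseteq> A"
  shows "eventually (\<lambda>i. map (\<lambda>g. g i)
      (map (\<lambda>X. SOME g. g \<in> X) (map (\<lambda>g. eq_mod U A `` {g}) gs)) = map (\<lambda>g. g i) gs) U
    \<and> (\<forall>g \<in> set (map (\<lambda>X. SOME g. g \<in> X) (map (\<lambda>g. eq_mod U A `` {g}) gs)). range g \<subseteq> A)"
  using assms
proof (induction gs)
  case Nil
  then show ?case by simp
next
  case (Cons g gs)
  have "g \<in> eq_mod U A `` {g}"
    using Cons.prems by (auto simp: eq_mod_def)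
  then have "(SOME h. h \<in> eq_mod U A `` {g}) \<in> eq_mod U A `` {g}"
    by (rule someI[of "\<lambda>h. h \<in> eq_mod U A `` {g}"])
  then have rg: "range (SOME h. h \<in> eq_mod U A `` {g}) \<subseteq> A"
    and ev: "eventually (\<lambda>i. g i = (SOME h. h \<in> eq_mod U A `` {g}) i) U"
    unfolding eq_mod_def by blast+
  have IH: "eventually (\<lambda>i. map (\<lambda>g. g i)
      (map (\<lambda>X. SOME g. g \<in> X) (map (\<lambda>g. eq_mod U A `` {g}) gs)) = map (\<lambda>g. g i) gs) U"
    and IH2: "\<forall>g \<in> set (map (\<lambda>X. SOME g. g \<in> X) (map (\<lambda>g. eq_mod U A `` {g}) gs)). range g \<subseteq> A"
    using Cons by (meson list.set_intros(2))+
  from eventually_conj[OF ev IH] show ?case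
    using rg IH2 by (auto elim!: eventually_mono)
qed

lemma fun_int_ultrapower:
  assumes "structure_of L M" "f \<in> Funs L" "length gs = fun_arity L f"
    and "\<forall>g \<in> set gs. range g \<subseteq> universe M"
  shows "fun_int (ultrapower M U) f (map (\<lambda>g. eq_mod U (universe M) `` {g}) gs) =
    eq_mod U (universe M) `` {\<lambda>i. fun_int M f (map (\<lambda>g. g i) gs)}"
proof -
  define hs where "hs =
    map (\<lambda>X. SOME g. g \<in> X) (map (\<lambda>g. eq_mod U (universe M) `` {g}) gs)"
  have ev: "eventually (\<lambda>i. map (\<lambda>g. g i) hs = map (\<lambda>g. g i) gs) U"
    and hs: "\<forall>g \<in> set hs. range g \<subseteq> universe M"
    using eventually_representatives[OF assms(4), of U] unfolding hs_def by blast+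
  have len: "length hs = length gs"
    by (simp add: hs_def)
  have cl: "fun_int M f (map (\<lambda>g. g i) ks) \<in> universe M"
    if "length ks = length gs" "\<forall>g \<in> set ks. range g \<subseteq> universe M" for i ks
  proof -
    have "map (\<lambda>g. g i) ks \<in> args (universe M) (fun_arity L f)"
      using that assms(3) by (auto simp: args_def)
    then show ?thesis using assms(1,2) by (auto simp: structure_of_def)
  qed
  have "((\<lambda>i. fun_int M f (map (\<lambda>g. g i) hs)), (\<lambda>i. fun_int M f (map (\<lambda>g. g i) gs)))
    \<in> eq_mod U (universe M)"
    unfolding eq_mod_def using cl[OF len hs] cl[OF refl assms(4)] ev
    by (auto elim!: eventually_mono)
  from equiv_class_eq[OF equiv_eq_mod this] show ?thesis
    by (simp add: ultrapower_def Let_def hs_def comp_assoc)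
qed

lemma rel_int_ultrapower:
  assumes "\<forall>g \<in> set gs. range g \<subseteq> universe M"
  shows "rel_int (ultrapower M U) r (map (\<lambda>g. eq_mod U (universe M) `` {g}) gs) \<longleftrightarrow>
    eventually (\<lambda>i. rel_int M r (map (\<lambda>g. g i) gs)) U"
proof -
  define hs where "hs =
    map (\<lambda>X. SOME g. g \<in> X) (map (\<lambda>g. eq_mod U (universe M) `` {g}) gs)"
  have "eventually (\<lambda>i. map (\<lambda>g. g i) hs = map (\<lambda>g. g i) gs) U"
    using eventually_representatives[OF assms, of U] unfolding hs_def by blast
  then have "eventually (\<lambda>i. rel_int M r (map (\<lambda>g. g i) hs) \<longleftrightarrow>
      rel_int M r (map (\<lambda>g. g i) gs)) U"
    by (rule eventually_mono) simp
  from eventually_subst[OF this] show ?thesis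
    by (simp add: ultrapower_def Let_def hs_def comp_assoc)
qed

text \<open>
  Cardinals are represented by well-orders, with \<open>natLeq\<close> for \<open>\<aleph>\<^sub>0\<close> and \<open>cardSuc natLeq\<close>
  for \<open>\<aleph>\<^sub>1\<close>.
\<close>

abbreviation continuum :: "(nat \<Rightarrow> bool) rel" where
  "continuum \<equiv> ctwo ^c natLeq"

definition continuum_hypothesis :: bool where
  "continuum_hypothesis \<longleftrightarrow> continuum =o cardSuc natLeq"

text \<open>
  The quantifiers over languages and structures range over fixed types, since a formula of HOL
  cannot quantify over types. If \<open>'f\<close> and \<open>'r\<close> are infinite, every countable language is
  represented up to renaming of its symbols; if \<open>'a\<close> and \<open>'b\<close> have at least \<open>2\<^bsup>\<aleph>\<^sub>0\<^esup>\<close> elements,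
  every structure of size at most \<open>2\<^bsup>\<aleph>\<^sub>0\<^esup>\<close> is represented up to isomorphism.
\<close>

definition keisler_criterion ::
    "'f itself \<Rightarrow> 'r itself \<Rightarrow> 'a itself \<Rightarrow> 'b itself \<Rightarrow> bool" where
  "keisler_criterion _ _ _ _ \<longleftrightarrow>
     (\<forall>(L :: ('f, 'r) language) (M :: ('f, 'r, 'a) struct) (N :: ('f, 'r, 'b) struct).
        countable_language L \<longrightarrow> structure_of L M \<longrightarrow> structure_of L N \<longrightarrow>
        |universe M| \<le>o continuum \<longrightarrow> |universe N| \<le>o continuum \<longrightarrow>
        (elementarily_equivalent L M N \<longleftrightarrow>
         (\<exists>U :: nat filter. ultrafilter U \<and>
            isomorphic L (ultrapower M U) (ultrapower N U))))"

end

theory Submission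
  imports Defs "HOL-Library.Countable_Set_Type"
begin

text \<open>
  Under the continuum hypothesis the ultrapowers by a free ultrafilter on \<open>\<omega>\<close> have size at most
  \<open>\<aleph>\<^sub>1\<close>, and they are \<open>\<aleph>\<^sub>1\<close>-saturated, so a back-and-forth construction of length \<open>\<omega>\<^sub>1\<close> makes them
  isomorphic when they are elementarily equivalent.

  If the continuum hypothesis fails, the lexicographic orders \<open>\<omega>\<^sub>1 \<times> \<rat>\<close> and \<open>\<omega>\<^sub>2 \<times> \<rat>\<close> both have
  size at most \<open>2\<^bsup>\<aleph>\<^sub>0\<^esup>\<close>. They are dense without endpoints, hence elementarily equivalent. A sequence
  indexed by \<open>\<omega>\<close> in an order of uncountable cofinality is bounded, so the diagonal is cofinal in an
  ultrapower by any ultrafilter on \<open>\<omega>\<close>; the two ultrapowers keep the cofinalities \<open>\<omega>\<^sub>1\<close> and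
  \<open>\<omega>\<^sub>2\<close> and are not isomorphic.
\<close>

section \<open>Satisfaction\<close>

lemma finite_vars_trm: "finite (vars_trm t)"
  by (induction t) auto

lemma finite_free_vars: "finite (free_vars p)"
  by (induction p) (auto simp: finite_vars_trm)

lemma eval_trm_cong:
  "(\<And>n. n \<in> vars_trm t \<Longrightarrow> v n = w n) \<Longrightarrow> eval_trm M v t = eval_trm M w t"
proof (induction t)
  case (Fn f ts)
  have "map (eval_trm M v) ts = map (eval_trm M w) ts"
    by (intro map_cong refl Fn.IH) (use Fn.prems in auto)
  then show ?case by (simp only: eval_trm.simps)
qed simp

lemma sat_cong:
  "(\<And>n. n \<in> free_vars p \<Longrightarrow> v n = w n) \<Longrightarrow> sat M v p = sat M w p"
proof (induction p arbitrary: v w)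
  case (Eql s t)
  then show ?case using eval_trm_cong[of s v w M] eval_trm_cong[of t v w M] by auto
next
  case (Rel r ts)
  then have "map (eval_trm M v) ts = map (eval_trm M w) ts"
    by (auto intro: eval_trm_cong)
  then show ?case by (simp only: sat.simps)
next
  case (Imp p q)
  from Imp.IH(1)[of v w] Imp.IH(2)[of v w] Imp.prems show ?case by auto
next
  case (All x p)
  have "sat M (v(x := a)) p = sat M (w(x := a)) p" for a
    by (rule All.IH) (use All.prems in auto)
  then show ?case by simp
qed simp

lemma eval_trm_in_universe:
  assumes "structure_of L M" "range v \<subseteq> universe M" "trm_of L t"
  shows "eval_trm M v t \<in> universe M"
  using assms(3)
proof (induction t)
  case (Var x)
  then show ?case using assms(2) by auto
next
  case (Fn f ts)
  then have "map (eval_trm M v) ts \<in> args (universe M) (fun_arity L f)"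
    by (auto simp: args_def)
  then show ?case using Fn assms(1) by (auto simp: structure_of_def)
qed

lemma models_sentence:
  assumes "sentence_of L p" "range v \<subseteq> universe M"
  shows "models M p \<longleftrightarrow> sat M v p"
  using assms sat_cong[of p _ v M] unfolding models_def sentence_of_def by blast

fun rename_trm :: "(nat \<Rightarrow> nat) \<Rightarrow> 'f trm \<Rightarrow> 'f trm" where
  "rename_trm s (Var x) = Var (s x)"
| "rename_trm s (Fn f ts) = Fn f (map (rename_trm s) ts)"

text \<open>Bound variables are renamed as well, so this is meaningful only for injective renamings.\<close>

fun rename :: "(nat \<Rightarrow> nat) \<Rightarrow> ('f, 'r) form \<Rightarrow> ('f, 'r) form" where
  "rename s Falsum = Falsum"
| "rename s (Eql t u) = Eql (rename_trm s t) (rename_trm s u)"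
| "rename s (Rel r ts) = Rel r (map (rename_trm s) ts)"
| "rename s (Imp p q) = Imp (rename s p) (rename s q)"
| "rename s (All x p) = All (s x) (rename s p)"

lemma eval_rename_trm: "eval_trm M v (rename_trm s t) = eval_trm M (v \<circ> s) t"
  by (induction t) (auto intro!: arg_cong[where f = "fun_int M _"])

lemma trm_of_rename: "trm_of L (rename_trm s t) = trm_of L t"
  by (induction t) auto

lemma form_of_rename: "form_of L (rename s p) = form_of L p"
  by (induction p) (auto simp: trm_of_rename)

lemma vars_rename_trm: "vars_trm (rename_trm s t) = s ` vars_trm t"
  by (induction t) auto

lemma free_vars_rename: "inj s \<Longrightarrow> free_vars (rename s p) = s ` free_vars p"
  by (induction p) (auto simp: vars_rename_trm inj_eq)

lemma sat_rename:
  assumes "inj s"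
  shows "sat M v (rename s p) = sat M (v \<circ> s) p"
proof (induction p arbitrary: v)
  case (Rel r ts)
  then show ?case by (simp add: eval_rename_trm comp_def)
next
  case (All x p)
  have "(v(s x := a)) \<circ> s = (v \<circ> s)(x := a)" for a
    using assms by (auto simp: inj_eq)
  then show ?case by (simp only: rename.simps sat.simps All)
qed (auto simp: eval_rename_trm)

lemma sat_foldr_Imp: "sat M v (foldr Imp ps Falsum) \<longleftrightarrow> \<not> (\<forall>p \<in> set ps. sat M v p)"
  by (induction ps) auto

lemma form_of_foldr_Imp: "form_of L (foldr Imp ps Falsum) \<longleftrightarrow> (\<forall>p \<in> set ps. form_of L p)"
  by (induction ps) auto

lemma free_vars_foldr_Imp: "free_vars (foldr Imp ps Falsum) = (\<Union>p \<in> set ps. free_vars p)"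
  by (induction ps) auto

instance trm :: (countable) countable
  by countable_datatype

instance form :: (countable, countable) countable
  by countable_datatype

lemma set_trm_subset: "trm_of L t \<Longrightarrow> set_trm t \<subseteq> Funs L"
  by (induction t) auto

lemma set_form_subset: "form_of L p \<Longrightarrow> set1_form p \<subseteq> Funs L \<and> set2_form p \<subseteq> Rels L"
  by (induction p) (auto dest: set_trm_subset)

lemma countable_form_of:
  assumes "countable_language L"
  shows "countable {p. form_of L p}"
proof -
  have f: "inj_on (to_nat_on (Funs L)) (Funs L)" and r: "inj_on (to_nat_on (Rels L)) (Rels L)"
    using assms by (auto simp: countable_language_def)
  have "inj_on (map_form (to_nat_on (Funs L)) (to_nat_on (Rels L))) {p. form_of L p}"
  proof (rule inj_onI)
    fix p q
    assume pq: "p \<in> {p. form_of L p}" "q \<in> {p. form_of L p}"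
      and eq: "map_form (to_nat_on (Funs L)) (to_nat_on (Rels L)) p =
        map_form (to_nat_on (Funs L)) (to_nat_on (Rels L)) q"
    show "p = q"
      by (rule form.inj_map_strong[OF _ _ eq])
        (use pq set_form_subset[of L] in \<open>auto dest!: inj_onD[OF f] inj_onD[OF r]\<close>)
  qed
  then show ?thesis
    by (rule countableI')
qed

lemma isomorphic_sat:
  assumes str: "structure_of L M"
    and bij: "bij_betw h (universe M) (universe N)"
    and funs: "\<And>f xs. f \<in> Funs L \<Longrightarrow> xs \<in> args (universe M) (fun_arity L f) \<Longrightarrow>
      h (fun_int M f xs) = fun_int N f (map h xs)"
    and rels: "\<And>r xs. r \<in> Rels L \<Longrightarrow> xs \<in> args (universe M) (rel_arity L r) \<Longrightarrow>
      rel_int M r xs \<longleftrightarrow> rel_int N r (map h xs)"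
    and p: "form_of L p" and v: "range v \<subseteq> universe M"
  shows "sat M v p = sat N (h \<circ> v) p"
proof -
  have trm: "h (eval_trm M v t) = eval_trm N (h \<circ> v) t"
    if "trm_of L t" "range v \<subseteq> universe M" for t v
    using that(1)
  proof (induction t)
    case (Fn f ts)
    then have "map (eval_trm M v) ts \<in> args (universe M) (fun_arity L f)"
      using eval_trm_in_universe[OF str that(2)] by (auto simp: args_def)
    with Fn.prems have "h (eval_trm M v (Fn f ts)) = fun_int N f (map h (map (eval_trm M v) ts))"
      by (simp add: funs)
    also have "map h (map (eval_trm M v) ts) = map (eval_trm N (h \<circ> v)) ts"
      using Fn by (auto simp: comp_def)
    finally show ?case by (simp add: comp_def)
  qed simp
  show ?thesis
    using p v
  proof (induction p arbitrary: v)
    case (Eql s t)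
    have "eval_trm M v s \<in> universe M" "eval_trm M v t \<in> universe M"
      using Eql eval_trm_in_universe[OF str] by auto
    with bij have "sat M v (Eql s t) \<longleftrightarrow> h (eval_trm M v s) = h (eval_trm M v t)"
      by (auto simp: bij_betw_def inj_on_eq_iff)
    then show ?case
      using Eql by (simp add: trm comp_def)
  next
    case (Rel r ts)
    then have "map (eval_trm M v) ts \<in> args (universe M) (rel_arity L r)"
      using eval_trm_in_universe[OF str Rel.prems(2)] by (auto simp: args_def)
    with Rel.prems have "sat M v (Rel r ts) = rel_int N r (map h (map (eval_trm M v) ts))"
      by (simp add: rels)
    also have "map h (map (eval_trm M v) ts) = map (eval_trm N (h \<circ> v)) ts"
      using Rel trm by auto
    finally show ?case by (simp add: comp_def)
  next
    case (All x p)
    have "sat M (v(x := a)) p = sat N ((h \<circ> v)(x := h a)) p" if "a \<in> universe M" for a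
    proof -
      have upd: "h \<circ> v(x := a) = (h \<circ> v)(x := h a)" by auto
      have "range (v(x := a)) \<subseteq> universe M" using All that by auto
      with All.IH[of "v(x := a)"] All.prems show ?thesis by (simp only: upd form_of.simps)
    qed
    then have "sat M v (All x p) \<longleftrightarrow> (\<forall>b \<in> h ` universe M. sat N ((h \<circ> v)(x := b)) p)"
      by simp
    moreover have "universe N = h ` universe M"
      using bij by (simp add: bij_betw_def)
    ultimately show ?case by (simp add: comp_def)
  qed auto
qed

lemma isomorphic_imp_elementarily_equivalent:
  assumes "structure_of L M" "isomorphic L M N"
  shows "elementarily_equivalent L M N"
  unfolding elementarily_equivalent_def
proof (intro allI impI)
  fix p
  assume p: "sentence_of L p"
  obtain h where bij: "bij_betw h (universe M) (universe N)"
    and h: "\<And>f xs. f \<in> Funs L \<Longrightarrow> xs \<in> args (universe M) (fun_arity L f) \<Longrightarrow>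
      h (fun_int M f xs) = fun_int N f (map h xs)"
    "\<And>r xs. r \<in> Rels L \<Longrightarrow> xs \<in> args (universe M) (rel_arity L r) \<Longrightarrow>
      rel_int M r xs \<longleftrightarrow> rel_int N r (map h xs)"
    using assms(2) unfolding isomorphic_def by blast
  obtain a where a: "a \<in> universe M"
    using assms(1) by (auto simp: structure_of_def)
  have "sat M (\<lambda>_. a) p = sat N (h \<circ> (\<lambda>_. a)) p"
    using p a by (intro isomorphic_sat[OF assms(1) bij h]) (auto simp: sentence_of_def)
  moreover have "range (h \<circ> (\<lambda>_. a)) \<subseteq> universe N"
    using a bij by (auto simp: bij_betw_def)
  ultimately show "models M p \<longleftrightarrow> models N p"
    using models_sentence[OF p, of "\<lambda>_. a" M] models_sentence[OF p, of "h \<circ> (\<lambda>_. a)" N] a by auto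
qed

lemma elementarily_equivalent_trans:
  "elementarily_equivalent L M N \<Longrightarrow> elementarily_equivalent L N K \<Longrightarrow> elementarily_equivalent L M K"
  by (simp add: elementarily_equivalent_def)

lemma elementarily_equivalent_sym:
  "elementarily_equivalent L M N \<Longrightarrow> elementarily_equivalent L N M"
  by (simp add: elementarily_equivalent_def)

section \<open>Ultrapowers\<close>

lemma ultrafilter_Not:
  assumes "ultrafilter U"
  shows "eventually (\<lambda>i. \<not> P i) U \<longleftrightarrow> \<not> eventually P U"
proof
  assume "eventually (\<lambda>i. \<not> P i) U"
  then show "\<not> eventually P U"
    using assms eventually_conj[of "\<lambda>i. \<not> P i" U P] by (auto simp: ultrafilter_def)
qed (use assms in \<open>auto simp: ultrafilter_def\<close>)

lemma ultrafilter_imp: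
  assumes "ultrafilter U"
  shows "eventually (\<lambda>i. P i \<longrightarrow> Q i) U \<longleftrightarrow> (eventually P U \<longrightarrow> eventually Q U)"
proof
  assume "eventually P U \<longrightarrow> eventually Q U"
  then have "eventually (\<lambda>i. \<not> P i) U \<or> eventually Q U"
    using ultrafilter_Not[OF assms, of P] by blast
  then show "eventually (\<lambda>i. P i \<longrightarrow> Q i) U"
    by (auto elim: eventually_mono)
qed (auto elim: eventually_mp)

lemma universe_ultrapower:
  "X \<in> universe (ultrapower M U) \<longleftrightarrow>
    (\<exists>g. range g \<subseteq> universe M \<and> X = eq_mod U (universe M) `` {g})"
  by (auto simp: ultrapower_def quotient_def)

lemma class_in_ultrapower:
  "range g \<subseteq> universe M \<Longrightarrow> eq_mod U (universe M) `` {g} \<in> universe (ultrapower M U)"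
  by (auto simp: universe_ultrapower)

lemma class_eq_iff:
  assumes "range g \<subseteq> A" "range h \<subseteq> A"
  shows "eq_mod U A `` {g} = eq_mod U A `` {h} \<longleftrightarrow> eventually (\<lambda>i. g i = h i) U"
  using eq_equiv_class_iff[OF equiv_eq_mod, of g A h U] assms by (auto simp: eq_mod_def)

lemma choose_representatives:
  assumes "range v \<subseteq> universe (ultrapower M U)"
  obtains g where "\<And>n. range (g n) \<subseteq> universe M" "v = (\<lambda>n. eq_mod U (universe M) `` {g n})"
proof -
  have "\<forall>n. \<exists>g. range g \<subseteq> universe M \<and> v n = eq_mod U (universe M) `` {g}"
    using assms universe_ultrapower by blast
  then obtain g where "\<forall>n. range (g n) \<subseteq> universe M \<and> v n = eq_mod U (universe M) `` {g n}"
    by metis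
  then show thesis
    using that[of g] by blast
qed

lemma choose_representatives_list:
  assumes "set Xs \<subseteq> universe (ultrapower M U)"
  obtains gs where "\<forall>g \<in> set gs. range g \<subseteq> universe M"
    "Xs = map (\<lambda>g. eq_mod U (universe M) `` {g}) gs"
proof -
  have "\<exists>gs. (\<forall>g \<in> set gs. range g \<subseteq> universe M) \<and>
      Xs = map (\<lambda>g. eq_mod U (universe M) `` {g}) gs"
    using assms
  proof (induction Xs)
    case (Cons X Xs)
    then obtain gs where gs: "\<forall>g \<in> set gs. range g \<subseteq> universe M"
      "Xs = map (\<lambda>g. eq_mod U (universe M) `` {g}) gs"
      by auto
    obtain g where "range g \<subseteq> universe M" "X = eq_mod U (universe M) `` {g}"
      using Cons.prems universe_ultrapower by (metis insert_subset list.set(2))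
    with gs show ?case by (intro exI[of _ "g # gs"]) auto
  qed simp
  then show thesis using that by blast
qed

lemma fun_int_in_universe:
  assumes "structure_of L M" "f \<in> Funs L" "length gs = fun_arity L f"
    and "\<forall>g \<in> set gs. range g \<subseteq> universe M"
  shows "fun_int M f (map (\<lambda>g. g i) gs) \<in> universe M"
proof -
  have "map (\<lambda>g. g i) gs \<in> args (universe M) (fun_arity L f)"
    using assms(3,4) by (auto simp: args_def)
  then show ?thesis using assms(1,2) by (auto simp: structure_of_def)
qed

lemma structure_of_ultrapower:
  assumes M: "structure_of L M"
  shows "structure_of L (ultrapower M U)"
  unfolding structure_of_def
proof (intro conjI ballI)
  obtain a where "a \<in> universe M"
    using M by (auto simp: structure_of_def)
  then show "universe (ultrapower M U) \<noteq> {}"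
    using class_in_ultrapower[of "\<lambda>_. a" M U] by auto
next
  fix f Xs
  assume f: "f \<in> Funs L" and Xs: "Xs \<in> args (universe (ultrapower M U)) (fun_arity L f)"
  obtain gs where gs: "\<forall>g \<in> set gs. range g \<subseteq> universe M"
    and Xs_eq: "Xs = map (\<lambda>g. eq_mod U (universe M) `` {g}) gs"
    using choose_representatives_list[of Xs M U] Xs by (auto simp: args_def)
  have len: "length gs = fun_arity L f"
    using Xs by (simp add: Xs_eq args_def)
  show "fun_int (ultrapower M U) f Xs \<in> universe (ultrapower M U)"
    unfolding Xs_eq fun_int_ultrapower[OF M f len gs]
    using fun_int_in_universe[OF M f len gs] by (intro class_in_ultrapower) auto
qed

lemma eval_trm_ultrapower:
  assumes M: "structure_of L M" and g: "\<And>n. range (g n) \<subseteq> universe M" and t: "trm_of L t"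
  shows "eval_trm (ultrapower M U) (\<lambda>n. eq_mod U (universe M) `` {g n}) t =
    eq_mod U (universe M) `` {\<lambda>i. eval_trm M (\<lambda>n. g n i) t}"
  using t
proof (induction t)
  case (Fn f ts)
  define gs where "gs = map (\<lambda>t i. eval_trm M (\<lambda>n. g n i) t) ts"
  have v: "range (\<lambda>n. g n i) \<subseteq> universe M" for i
    using g by blast
  have "\<forall>h \<in> set gs. range h \<subseteq> universe M"
    using Fn.prems eval_trm_in_universe[OF M v] by (auto simp: gs_def)
  moreover have ts: "map (eval_trm (ultrapower M U) (\<lambda>n. eq_mod U (universe M) `` {g n})) ts =
      map (\<lambda>g. eq_mod U (universe M) `` {g}) gs"
    using Fn by (auto simp: gs_def)
  ultimately show ?case
    unfolding eval_trm.simps ts using fun_int_ultrapower[OF M, of f gs U] Fn.prems by (simp add: gs_def comp_def)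
qed simp

theorem Los:
  assumes U: "ultrafilter U" and M: "structure_of L M"
    and "\<And>n. range (g n) \<subseteq> universe M" and "form_of L p"
  shows "sat (ultrapower M U) (\<lambda>n. eq_mod U (universe M) `` {g n}) p \<longleftrightarrow>
    eventually (\<lambda>i. sat M (\<lambda>n. g n i) p) U"
  using assms(3,4)
proof (induction p arbitrary: g)
  case Falsum
  then show ?case using U by (simp add: ultrafilter_def)
next
  case (Eql s t)
  have v: "range (\<lambda>n. g n i) \<subseteq> universe M" for i
    using Eql.prems(1) by blast
  have "range (\<lambda>i. eval_trm M (\<lambda>n. g n i) s) \<subseteq> universe M"
    "range (\<lambda>i. eval_trm M (\<lambda>n. g n i) t) \<subseteq> universe M"
    using eval_trm_in_universe[OF M v] Eql.prems(2) by auto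
  then show ?case
    using Eql.prems by (simp add: eval_trm_ultrapower[OF M] class_eq_iff)
next
  case (Rel r ts)
  define gs where "gs = map (\<lambda>t i. eval_trm M (\<lambda>n. g n i) t) ts"
  have v: "range (\<lambda>n. g n i) \<subseteq> universe M" for i
    using Rel.prems(1) by blast
  have "\<forall>h \<in> set gs. range h \<subseteq> universe M"
    using Rel.prems eval_trm_in_universe[OF M v] by (auto simp: gs_def)
  moreover have ts: "map (eval_trm (ultrapower M U) (\<lambda>n. eq_mod U (universe M) `` {g n})) ts =
      map (\<lambda>g. eq_mod U (universe M) `` {g}) gs"
    using Rel.prems by (auto simp: gs_def eval_trm_ultrapower[OF M])
  ultimately show ?case
    unfolding sat.simps ts using rel_int_ultrapower[of gs M U r] by (simp add: gs_def comp_def)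
next
  case (Imp p q)
  then show ?case by (simp add: ultrafilter_imp[OF U])
next
  case (All x p)
  have upd: "(\<lambda>n. eq_mod U (universe M) `` {g n})(x := eq_mod U (universe M) `` {h}) =
      (\<lambda>n. eq_mod U (universe M) `` {(g(x := h)) n})" for h
    by (rule ext) simp
  have upd2: "(\<lambda>n. (g(x := h)) n i) = (\<lambda>n. g n i)(x := h i)" for h i
    by auto
  have IH: "sat (ultrapower M U)
        ((\<lambda>n. eq_mod U (universe M) `` {g n})(x := eq_mod U (universe M) `` {h})) p \<longleftrightarrow>
      eventually (\<lambda>i. sat M ((\<lambda>n. g n i)(x := h i)) p) U" if "range h \<subseteq> universe M" for h
    unfolding upd
    using All.IH[of "g(x := h)"] All.prems that unfolding upd2 by (simp add: fun_upd_apply)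
  have "(\<forall>h. range h \<subseteq> universe M \<longrightarrow>
      eventually (\<lambda>i. sat M ((\<lambda>n. g n i)(x := h i)) p) U) \<longleftrightarrow>
    eventually (\<lambda>i. \<forall>a \<in> universe M. sat M ((\<lambda>n. g n i)(x := a)) p) U"
    (is "?L \<longleftrightarrow> eventually ?R U")
  proof
    assume L: ?L
    obtain a0 where a0: "a0 \<in> universe M"
      using M by (auto simp: structure_of_def)
    define h where "h i = (if ?R i then a0
      else SOME a. a \<in> universe M \<and> \<not> sat M ((\<lambda>n. g n i)(x := a)) p)" for i
    have h: "h i \<in> universe M \<and> (?R i \<or> \<not> sat M ((\<lambda>n. g n i)(x := h i)) p)" for i
    proof (cases "?R i")
      case False
      then have "\<exists>a. a \<in> universe M \<and> \<not> sat M ((\<lambda>n. g n i)(x := a)) p" by blast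
      from someI_ex[OF this] False a0 show ?thesis by (simp add: h_def)
    qed (use a0 in \<open>simp add: h_def\<close>)
    then have "eventually (\<lambda>i. sat M ((\<lambda>n. g n i)(x := h i)) p) U"
      using L by blast
    then show "eventually ?R U"
      by (rule eventually_mono) (use h in blast)
  next
    assume R: "eventually ?R U"
    show ?L
      by (intro allI impI eventually_mono[OF R]) blast
  qed
  moreover have "sat (ultrapower M U) (\<lambda>n. eq_mod U (universe M) `` {g n}) (All x p) \<longleftrightarrow>
      (\<forall>h. range h \<subseteq> universe M \<longrightarrow>
        eventually (\<lambda>i. sat M ((\<lambda>n. g n i)(x := h i)) p) U)"
    using IH unfolding sat.simps Ball_def universe_ultrapower by blast
  ultimately show ?case by simp
qed

lemma elementarily_equivalent_ultrapower:
  assumes U: "ultrafilter U" and M: "structure_of L M"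
  shows "elementarily_equivalent L M (ultrapower M U)"
  unfolding elementarily_equivalent_def
proof (intro allI impI)
  fix p
  assume p: "sentence_of L p"
  obtain a where a: "a \<in> universe M"
    using M by (auto simp: structure_of_def)
  have "models M p \<longleftrightarrow> eventually (\<lambda>i. sat M (\<lambda>n. a) p) U"
    using U a models_sentence[OF p, of "\<lambda>_. a" M] by (auto simp: ultrafilter_def)
  also have "\<dots> \<longleftrightarrow> sat (ultrapower M U) (\<lambda>n. eq_mod U (universe M) `` {\<lambda>_. a}) p"
    using Los[OF U M, of "\<lambda>_ _. a" p] p a by (auto simp: sentence_of_def)
  also have "\<dots> \<longleftrightarrow> models (ultrapower M U) p"
    using class_in_ultrapower[of "\<lambda>_. a" M U] a
    by (intro models_sentence[OF p, symmetric]) auto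
  finally show "models M p \<longleftrightarrow> models (ultrapower M U) p" .
qed

lemma isomorphic_ultrapowers_imp_elementarily_equivalent:
  assumes "ultrafilter U" "structure_of L M" "structure_of L N"
    and "isomorphic L (ultrapower M U) (ultrapower N U)"
  shows "elementarily_equivalent L M N"
  using assms elementarily_equivalent_ultrapower elementarily_equivalent_sym
    elementarily_equivalent_trans isomorphic_imp_elementarily_equivalent structure_of_ultrapower
  by metis

lemma ultrafilter_exists:
  assumes "F \<noteq> bot"
  obtains U where "ultrafilter U" "U \<le> F"
proof -
  define A where "A = {G. G \<noteq> bot \<and> G \<le> F}"
  have "\<exists>m \<in> A. \<forall>a \<in> A. a \<le> m \<longrightarrow> a = m"
  proof (rule predicate_Zorn)
    show "partial_order_on A (relation_of (\<lambda>x y. y \<le> x) A)"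
      by (rule partial_order_on_relation_ofI) simp_all
  next
    fix C
    assume C: "C \<in> Chains (relation_of (\<lambda>x y. y \<le> x) A)"
    have sub: "C \<subseteq> A"
      using C unfolding Chains_def relation_of_def by blast
    have ch: "x \<le> y \<or> y \<le> x" if "x \<in> C" "y \<in> C" for x y
      using C that by (auto simp: Chains_def relation_of_def)
    show "\<exists>u \<in> A. \<forall>a \<in> C. u \<le> a"
    proof (cases "C = {}")
      case True
      moreover have "F \<in> A" by (simp add: A_def assms)
      ultimately show ?thesis by auto
    next
      case False
      have "eventually P (Inf C) \<longleftrightarrow> (\<exists>b \<in> C. eventually P b)" for P
      proof (rule eventually_Inf_base[OF False])
        fix x y
        assume xy: "x \<in> C" "y \<in> C"
        from ch[OF this] have "x \<le> inf x y \<or> y \<le> inf x y"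
          by (metis inf.absorb1 inf.absorb2 order_refl)
        then show "\<exists>z \<in> C. z \<le> inf x y"
          using xy by metis
      qed
      from this[of "\<lambda>_. False"] have "Inf C \<noteq> bot"
        using sub by (auto simp: eventually_False A_def)
      obtain b where b: "b \<in> C"
        using False by auto
      then have "b \<le> F"
        using sub by (auto simp: A_def)
      with Inf_lower[OF b] have "Inf C \<le> F"
        by (rule order_trans)
      with \<open>Inf C \<noteq> bot\<close> have "Inf C \<in> A"
        by (simp add: A_def)
      then show ?thesis
        by (rule bexI[rotated]) (auto intro: Inf_lower)
    qed
  qed
  then obtain m where mA: "m \<in> A" and mmin: "\<forall>a \<in> A. a \<le> m \<longrightarrow> a = m"
    by (rule bexE)
  have m: "m \<noteq> bot" "m \<le> F"
    using mA by (simp_all add: A_def)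
  have min: "a = m" if "a \<noteq> bot" "a \<le> F" "a \<le> m" for a
    by (rule mmin[rule_format]) (simp_all only: A_def mem_Collect_eq that simp_thms)
  have "eventually P m \<or> eventually (\<lambda>i. \<not> P i) m" for P
  proof (cases "inf m (principal {i. P i}) = bot")
    case True
    then show ?thesis
      using eventually_inf_principal[of "\<lambda>_. False" m "{i. P i}"] by simp
  next
    case False
    then have "inf m (principal {i. P i}) = m"
      by (rule min) (rule le_infI1[OF m(2)], rule inf_le1)
    moreover have "eventually P (inf m (principal {i. P i}))"
      by (simp add: eventually_inf_principal)
    ultimately show ?thesis by simp
  qed
  with m(1) have "ultrafilter m"
    by (simp add: ultrafilter_def)
  then show thesis
    using m(2) by (rule that)
qed

section \<open>Saturation\<close>

text \<open>
  Countably many parameters are listed by the valuation; since the language is countable,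
  \<open>\<Gamma>\<close> ranges over all types over them.
\<close>

definition saturated :: "('f, 'r) language \<Rightarrow> ('f, 'r, 'a) struct \<Rightarrow> bool" where
  "saturated L M \<longleftrightarrow> (\<forall>v \<Gamma>. range v \<subseteq> universe M \<longrightarrow> (\<forall>p \<in> \<Gamma>. form_of L p) \<longrightarrow>
     (\<forall>\<Delta> \<subseteq> \<Gamma>. finite \<Delta> \<longrightarrow> (\<exists>b \<in> universe M. \<forall>p \<in> \<Delta>. sat M (v(0 := b)) p)) \<longrightarrow>
     (\<exists>b \<in> universe M. \<forall>p \<in> \<Gamma>. sat M (v(0 := b)) p))"

lemma saturated_ultrapower:
  fixes U :: "nat filter"
  assumes U: "ultrafilter U" and free: "U \<le> sequentially"
    and L: "countable_language L" and M: "structure_of L M"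
  shows "saturated L (ultrapower M U)"
  unfolding saturated_def
proof (intro allI impI)
  fix v \<Gamma>
  assume v: "range v \<subseteq> universe (ultrapower M U)" and \<Gamma>: "\<forall>p \<in> \<Gamma>. form_of L p"
    and fin: "\<forall>\<Delta> \<subseteq> \<Gamma>. finite \<Delta> \<longrightarrow>
      (\<exists>b \<in> universe (ultrapower M U). \<forall>p \<in> \<Delta>. sat (ultrapower M U) (v(0 := b)) p)"
  obtain g where g: "\<And>n. range (g n) \<subseteq> universe M"
    and v_eq: "v = (\<lambda>n. eq_mod U (universe M) `` {g n})"
    using that by (rule choose_representatives[OF v])
  have los: "sat (ultrapower M U) (v(0 := eq_mod U (universe M) `` {h})) p \<longleftrightarrow>
      eventually (\<lambda>i. sat M ((\<lambda>n. g n i)(0 := h i)) p) U"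
    if h: "range h \<subseteq> universe M" and p: "p \<in> \<Gamma>" for h p
  proof -
    have 1: "v(0 := eq_mod U (universe M) `` {h}) =
        (\<lambda>n. eq_mod U (universe M) `` {(g(0 := h)) n})"
      by (rule ext) (simp add: v_eq)
    have 2: "(\<lambda>n. (g(0 := h)) n i) = (\<lambda>n. g n i)(0 := h i)" for i
      by auto
    have r: "range ((g(0 := h)) n) \<subseteq> universe M" for n
      using g h by (cases "n = 0") auto
    show ?thesis
      unfolding 1 2[symmetric] by (rule Los[OF U M r]) (use p \<Gamma> in blast)
  qed
  show "\<exists>b \<in> universe (ultrapower M U). \<forall>p \<in> \<Gamma>. sat (ultrapower M U) (v(0 := b)) p"
  proof (cases "\<Gamma> = {}")
    case True
    moreover have "v 0 \<in> universe (ultrapower M U)" using v by blast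
    ultimately show ?thesis by blast
  next
    case False
    have "countable \<Gamma>"
      using \<Gamma> by (intro countable_subset[OF _ countable_form_of[OF L]]) auto
    define ps where "ps = from_nat_into \<Gamma>"
    have ps: "range ps = \<Gamma>"
      using False \<open>countable \<Gamma>\<close> by (simp add: ps_def range_from_nat_into)
    define C where "C n i \<longleftrightarrow>
      (\<exists>c \<in> universe M. \<forall>k < n. sat M ((\<lambda>m. g m i)(0 := c)) (ps k))" for n i
    have C: "eventually (C n) U" for n
    proof -
      have "ps ` {..<n} \<subseteq> \<Gamma>" "finite (ps ` {..<n})"
        using ps by auto
      then have "\<exists>b \<in> universe (ultrapower M U). \<forall>k \<in> {..<n}. sat (ultrapower M U) (v(0 := b)) (ps k)"
        using fin by (metis (no_types, lifting) imageI)
      then obtain b where bU: "b \<in> universe (ultrapower M U)"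
        and b: "\<And>k. k < n \<Longrightarrow> sat (ultrapower M U) (v(0 := b)) (ps k)"
        by (metis lessThan_iff)
      obtain h where h: "range h \<subseteq> universe M" "b = eq_mod U (universe M) `` {h}"
        using bU[unfolded universe_ultrapower] by (elim exE conjE)
      have "eventually (\<lambda>i. sat M ((\<lambda>m. g m i)(0 := h i)) (ps k)) U" if "k < n" for k
      proof -
        have "ps k \<in> \<Gamma>" using ps by auto
        from los[OF h(1) this] b[OF that] show ?thesis
          unfolding h(2) by (rule iffD1)
      qed
      then have "eventually (\<lambda>i. \<forall>k \<in> {..<n}. sat M ((\<lambda>m. g m i)(0 := h i)) (ps k)) U"
        by (intro eventually_ball_finite) auto
      moreover have "C n i" if "\<forall>k \<in> {..<n}. sat M ((\<lambda>m. g m i)(0 := h i)) (ps k)" for i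
        unfolding C_def using that h(1) by blast
      ultimately show ?thesis
        by (rule eventually_mono)
    qed
    have C0: "C 0 i" for i
      using M by (auto simp: C_def structure_of_def)
    \<comment> \<open>At coordinate \<open>i\<close> as many of the first \<open>i\<close> formulas as possible are satisfied together.\<close>
    define N where "N i = (GREATEST n. n \<le> i \<and> C n i)" for i
    have N: "N i \<le> i \<and> C (N i) i" for i
      unfolding N_def by (rule GreatestI_nat[of _ 0 i]) (simp_all add: C0)
    have N_ge: "n \<le> N i" if "n \<le> i" "C n i" for n i
      unfolding N_def by (rule Greatest_le_nat[of _ _ i]) (simp_all add: that)
    have "\<forall>i. \<exists>c. c \<in> universe M \<and> (\<forall>k < N i. sat M ((\<lambda>m. g m i)(0 := c)) (ps k))"
      using N unfolding C_def by blast
    from choice[OF this] obtain h where h: "\<And>i. h i \<in> universe M"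
      "\<And>i k. k < N i \<Longrightarrow> sat M ((\<lambda>m. g m i)(0 := h i)) (ps k)"
      by blast
    have hr: "range h \<subseteq> universe M"
      using h by auto
    have "sat (ultrapower M U) (v(0 := eq_mod U (universe M) `` {h})) p" if p: "p \<in> \<Gamma>" for p
    proof -
      obtain k where k: "p = ps k"
        using ps p by auto
      have "eventually (\<lambda>i. Suc k \<le> i) U"
        using free eventually_ge_at_top by (rule filter_leD)
      with C have "eventually (\<lambda>i. C (Suc k) i \<and> Suc k \<le> i) U"
        by (intro eventually_conj)
      then have "eventually (\<lambda>i. sat M ((\<lambda>m. g m i)(0 := h i)) p) U"
      proof (rule eventually_mono)
        fix i
        assume "C (Suc k) i \<and> Suc k \<le> i"
        then have "k < N i" using N_ge[of "Suc k" i] by simp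
        then show "sat M ((\<lambda>m. g m i)(0 := h i)) p" unfolding k by (rule h(2))
      qed
      then show ?thesis
        using los[OF hr p] by simp
    qed
    then show ?thesis
      using class_in_ultrapower[OF hr] by blast
  qed
qed

section \<open>Back and forth along \<open>\<omega>\<^sub>1\<close>\<close>

definition elementary_map ::
    "('f, 'r) language \<Rightarrow> ('f, 'r, 'a) struct \<Rightarrow> ('f, 'r, 'b) struct \<Rightarrow> ('a \<times> 'b) set \<Rightarrow> bool" where
  "elementary_map L M N f \<longleftrightarrow> f \<subseteq> universe M \<times> universe N \<and>
     (\<forall>p v w. form_of L p \<longrightarrow> range v \<subseteq> universe M \<longrightarrow> range w \<subseteq> universe N \<longrightarrow>
        (\<forall>n \<in> free_vars p. (v n, w n) \<in> f) \<longrightarrow> sat M v p = sat N w p)"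

lemma elementary_mapD:
  assumes "elementary_map L M N f" "form_of L p" "range v \<subseteq> universe M" "range w \<subseteq> universe N"
    and "\<And>n. n \<in> free_vars p \<Longrightarrow> (v n, w n) \<in> f"
  shows "sat M v p = sat N w p"
  using assms unfolding elementary_map_def by blast

lemma elementary_map_converse:
  assumes "elementary_map L M N f"
  shows "elementary_map L N M (f\<inverse>)"
  unfolding elementary_map_def
proof (intro conjI allI impI)
  show "f\<inverse> \<subseteq> universe N \<times> universe M"
    using assms by (auto simp: elementary_map_def)
next
  fix p v w
  assume "form_of L p" "range v \<subseteq> universe N" "range w \<subseteq> universe M"
    and "\<forall>n \<in> free_vars p. (v n, w n) \<in> f\<inverse>"
  then show "sat N v p = sat M w p"
    by (intro elementary_mapD[OF assms, symmetric]) simp_all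
qed

lemma elementary_map_empty:
  assumes "elementarily_equivalent L M N"
  shows "elementary_map L M N {}"
  unfolding elementary_map_def
proof (intro conjI allI impI)
  fix p v w
  assume p: "form_of L p" "\<forall>n \<in> free_vars p. (v n, w n) \<in> {}"
    and v: "range v \<subseteq> universe M" and w: "range w \<subseteq> universe N"
  then have "sentence_of L p"
    by (auto simp: sentence_of_def)
  with models_sentence[OF this v] models_sentence[OF this w] assms
  show "sat M v p = sat N w p"
    by (simp add: elementarily_equivalent_def)
qed simp

lemma elementary_map_Union:
  assumes "\<And>f. f \<in> F \<Longrightarrow> elementary_map L M N f" "F \<noteq> {}"
    and chain: "\<And>f g. f \<in> F \<Longrightarrow> g \<in> F \<Longrightarrow> f \<subseteq> g \<or> g \<subseteq> f"
  shows "elementary_map L M N (\<Union>F)"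
  unfolding elementary_map_def
proof (intro conjI allI impI)
  show "\<Union>F \<subseteq> universe M \<times> universe N"
    using assms(1) by (auto simp: elementary_map_def)
next
  fix p v w
  assume p: "form_of L p" "range v \<subseteq> universe M" "range w \<subseteq> universe N"
    and vw: "\<forall>n \<in> free_vars p. (v n, w n) \<in> \<Union>F"
  have "\<exists>f \<in> F. \<forall>n \<in> X. (v n, w n) \<in> f" if "finite X" "X \<subseteq> free_vars p" for X
    using that
  proof (induction X)
    case empty
    then show ?case using \<open>F \<noteq> {}\<close> by auto
  next
    case (insert x X)
    then obtain f where f: "f \<in> F" "\<forall>n \<in> X. (v n, w n) \<in> f"
      by auto
    obtain g where g: "g \<in> F" "(v x, w x) \<in> g"
      using vw insert.prems by auto
    from chain[OF f(1) g(1)] show ?case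
    proof
      assume "f \<subseteq> g"
      then show ?thesis using f(2) g by (intro bexI[of _ g]) auto
    next
      assume "g \<subseteq> f"
      then show ?thesis using f g(2) by (intro bexI[of _ f]) auto
    qed
  qed
  from this[OF finite_free_vars order_refl]
  obtain f where f: "f \<in> F" "\<forall>n \<in> free_vars p. (v n, w n) \<in> f"
    by (rule bexE)
  show "sat M v p = sat N w p"
    by (rule elementary_mapD[OF assms(1)[OF f(1)] p]) (use f(2) in simp)
qed

text \<open>
  Formulas whose variables are evaluated without repetitions are handled by an injective renaming;
  a repetition \<open>(v x, w x) = (v y, w y)\<close> is eliminated by binding \<open>y\<close> in
  \<open>\<forall>y. y = x \<longrightarrow> p\<close>.
\<close>

lemma elementary_map_enumeration:
  assumes e: "range e \<subseteq> universe M" "range e' \<subseteq> universe N"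
    and eq: "\<And>p. form_of L p \<Longrightarrow> free_vars p \<subseteq> D \<Longrightarrow> sat M e p = sat N e' p"
  shows "elementary_map L M N ((\<lambda>n. (e n, e' n)) ` D)"
  unfolding elementary_map_def
proof (intro conjI allI impI)
  show "(\<lambda>n. (e n, e' n)) ` D \<subseteq> universe M \<times> universe N"
    using e by auto
next
  fix p v w
  assume "form_of L p" and v: "range v \<subseteq> universe M" and w: "range w \<subseteq> universe N"
    and "\<forall>n \<in> free_vars p. (v n, w n) \<in> (\<lambda>n. (e n, e' n)) ` D"
  then show "sat M v p = sat N w p"
  proof (induction "card (free_vars p)" arbitrary: p rule: less_induct)
    case less
    show ?case
    proof (cases "inj_on (\<lambda>n. (v n, w n)) (free_vars p)")
      case True
      have "\<forall>n. \<exists>m. n \<in> free_vars p \<longrightarrow> m \<in> D \<and> v n = e m \<and> w n = e' m"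
        using less.prems(4) by blast
      from choice[OF this] obtain t where t: "\<And>n. n \<in> free_vars p \<Longrightarrow> t n \<in> D"
        "\<And>n. n \<in> free_vars p \<Longrightarrow> v n = e (t n)" "\<And>n. n \<in> free_vars p \<Longrightarrow> w n = e' (t n)"
        by blast
      define K where "K = Suc (Max (insert 0 (t ` free_vars p)))"
      have K: "t n < K" if "n \<in> free_vars p" for n
        using that finite_free_vars[of p] by (auto simp: K_def less_Suc_eq_le)
      define s where "s n = (if n \<in> free_vars p then t n else n + K)" for n
      have "inj s"
      proof (rule injI)
        fix m n
        assume mn: "s m = s n"
        consider "m \<in> free_vars p" "n \<in> free_vars p" | "m \<in> free_vars p" "n \<notin> free_vars p"
          | "m \<notin> free_vars p" "n \<in> free_vars p" | "m \<notin> free_vars p" "n \<notin> free_vars p"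
          by blast
        then show "m = n"
        proof cases
          case 1
          then have "(v m, w m) = (v n, w n)"
            using mn t by (simp add: s_def)
          then show ?thesis
            using True 1 by (auto dest: inj_onD)
        next
          case 2
          then show ?thesis using mn K[of m] by (simp add: s_def)
        next
          case 3
          then show ?thesis using mn K[of n] by (simp add: s_def)
        qed (use mn in \<open>simp add: s_def\<close>)
      qed
      have "sat M v p = sat M (e \<circ> s) p"
        by (rule sat_cong) (simp add: s_def t)
      also have "\<dots> = sat M e (rename s p)"
        by (simp only: sat_rename[OF \<open>inj s\<close>])
      also have "\<dots> = sat N e' (rename s p)"
        by (rule eq) (use less.prems(1) t(1) in
          \<open>auto simp: form_of_rename free_vars_rename[OF \<open>inj s\<close>] s_def\<close>)
      also have "\<dots> = sat N (e' \<circ> s) p"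
        by (simp only: sat_rename[OF \<open>inj s\<close>])
      also have "\<dots> = sat N w p"
        by (rule sat_cong) (simp add: s_def t)
      finally show ?thesis .
    next
      case False
      then obtain x y where xy: "x \<in> free_vars p" "y \<in> free_vars p" "x \<noteq> y" "v x = v y" "w x = w y"
        by (auto simp: inj_on_def)
      define q where "q = All y (Imp (Eql (Var y) (Var x)) p)"
      have fq: "free_vars q = free_vars p - {y}"
        using xy by (auto simp: q_def)
      have "v y \<in> universe M" "w y \<in> universe N"
        using v w by auto
      then have q: "sat M v q = sat M v p" "sat N w q = sat N w p"
        using xy by (auto simp: q_def fun_upd_idem)
      have "sat M v q = sat N w q"
      proof (rule less.hyps)
        show "card (free_vars q) < card (free_vars p)"
          unfolding fq using xy(2) finite_free_vars[of p] by (rule card_Diff1_less[rotated])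
        show "form_of L q"
          using less.prems(1) by (simp add: q_def)
        show "\<forall>n \<in> free_vars q. (v n, w n) \<in> (\<lambda>n. (e n, e' n)) ` D"
          using less.prems(4) fq by blast
      qed (use v w in auto)
      with q show ?thesis by simp
    qed
  qed
qed

lemma elementary_map_extend:
  assumes f: "elementary_map L M N f" and cf: "countable f"
    and sat: "saturated L N" and ne: "universe N \<noteq> {}" and a: "a \<in> universe M"
  shows "\<exists>b. elementary_map L M N (insert (a, b) f)"
proof -
  obtain b0 where b0: "b0 \<in> universe N"
    using ne by blast
  obtain e e' and D :: "nat set" where D: "0 \<notin> D" "f = (\<lambda>n. (e n, e' n)) ` D"
    and e: "range e \<subseteq> universe M" "range e' \<subseteq> universe N"
  proof (cases "f = {}")
    case True
    then show thesis
      using that[of "{}" "\<lambda>_. a" "\<lambda>_. b0"] a b0 by auto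
  next
    case False
    define h where "h n = from_nat_into f (n - 1)" for n
    have r: "h ` {1..} = f"
    proof -
      have "h ` {1..} = from_nat_into f ` (\<lambda>n. n - 1) ` {1..}"
        by (simp add: h_def image_image)
      also have "(\<lambda>n. n - 1) ` {1..} = (UNIV :: nat set)"
        by (auto simp: image_iff intro!: bexI[of _ "Suc _"])
      finally show ?thesis
        using False cf by (simp add: range_from_nat_into)
    qed
    have "h n \<in> universe M \<times> universe N" for n
      using from_nat_into[OF False, of "n - 1"] f by (auto simp: h_def elementary_map_def)
    then have "range (fst \<circ> h) \<subseteq> universe M" "range (snd \<circ> h) \<subseteq> universe N"
      by (auto simp: mem_Times_iff)
    then show thesis
      using that[of "{1..}" "fst \<circ> h" "snd \<circ> h"] r by simp
  qed
  have eq: "sat M e p = sat N e' p" if "form_of L p" "free_vars p \<subseteq> D" for p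
    by (rule elementary_mapD[OF f that(1) e]) (use that(2) D(2) in auto)
  define \<Gamma> where
    "\<Gamma> = {p. form_of L p \<and> free_vars p \<subseteq> insert 0 D \<and> sat M (e(0 := a)) p}"
  have "\<exists>b \<in> universe N. \<forall>p \<in> \<Delta>. sat N (e'(0 := b)) p" if \<Delta>: "\<Delta> \<subseteq> \<Gamma>" "finite \<Delta>" for \<Delta>
  proof -
    obtain ps where ps: "set ps = \<Delta>"
      using \<Delta>(2) finite_list by blast
    define q where "q = All 0 (foldr Imp ps Falsum)"
    have "form_of L q" "free_vars q \<subseteq> D"
      using \<Delta>(1) ps D(1) by (auto simp: q_def form_of_foldr_Imp free_vars_foldr_Imp \<Gamma>_def)
    then have "sat M e q = sat N e' q"
      by (rule eq)
    moreover have "\<not> sat M e q"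
      using a \<Delta>(1) ps by (auto simp: q_def sat_foldr_Imp \<Gamma>_def)
    ultimately show ?thesis
      using ps by (auto simp: q_def sat_foldr_Imp)
  qed
  moreover have "\<forall>p \<in> \<Gamma>. form_of L p"
    by (simp add: \<Gamma>_def)
  ultimately have "\<exists>b \<in> universe N. \<forall>p \<in> \<Gamma>. sat N (e'(0 := b)) p"
    using sat[unfolded saturated_def, rule_format, OF e(2), of \<Gamma>] by simp
  then obtain b where b: "b \<in> universe N" "\<forall>p \<in> \<Gamma>. sat N (e'(0 := b)) p"
    by (rule bexE)
  have eq': "sat M (e(0 := a)) p = sat N (e'(0 := b)) p"
    if "form_of L p" "free_vars p \<subseteq> insert 0 D" for p
  proof (cases "sat M (e(0 := a)) p")
    case True
    then show ?thesis using that b(2) by (simp add: \<Gamma>_def)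
  next
    case False
    then have "Imp p Falsum \<in> \<Gamma>"
      using that by (simp add: \<Gamma>_def)
    with b(2) have "sat N (e'(0 := b)) (Imp p Falsum)"
      by (rule bspec)
    then show ?thesis using False by simp
  qed
  have "elementary_map L M N ((\<lambda>n. ((e(0 := a)) n, (e'(0 := b)) n)) ` insert 0 D)"
    by (rule elementary_map_enumeration[OF _ _ eq']) (use e a b(1) in \<open>auto split: if_splits\<close>)
  also have "(\<lambda>n. ((e(0 := a)) n, (e'(0 := b)) n)) ` insert 0 D = insert (a, b) f"
  proof -
    have "(\<lambda>n. ((e(0 := a)) n, (e'(0 := b)) n)) ` D = f"
      unfolding D(2) by (rule image_cong) (use D(1) in auto)
    then show ?thesis by (simp only: image_insert fun_upd_same)
  qed
  finally show ?thesis ..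
qed

lemma elementary_map_extend_both:
  assumes f: "elementary_map L M N f" and cf: "countable f"
    and "saturated L M" "saturated L N"
    and a: "a \<in> universe M" and b: "b \<in> universe N"
  shows "\<exists>g. f \<subseteq> g \<and> elementary_map L M N g \<and> countable g \<and> a \<in> Domain g \<and> b \<in> Range g"
proof -
  obtain b' where b': "elementary_map L M N (insert (a, b') f)"
    using elementary_map_extend[OF f cf \<open>saturated L N\<close> _ a] b by blast
  have "(insert (a, b') f)\<inverse> = prod.swap ` insert (a, b') f"
    by force
  then have "countable ((insert (a, b') f)\<inverse>)"
    using cf by simp
  then obtain a' where "elementary_map L N M (insert (b, a') ((insert (a, b') f)\<inverse>))"
    using elementary_map_extend[OF elementary_map_converse[OF b'] _ \<open>saturated L M\<close> _ b] a by blast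
  moreover have "(insert (b, a') ((insert (a, b') f)\<inverse>))\<inverse> = insert (a', b) (insert (a, b') f)"
    by auto
  ultimately have "elementary_map L M N (insert (a', b) (insert (a, b') f))"
    by (metis elementary_map_converse)
  then show ?thesis
    using cf by (intro exI[of _ "insert (a', b) (insert (a, b') f)"]) auto
qed

lemma elementary_map_total_imp_isomorphic:
  assumes M: "structure_of L M" and N: "structure_of L N" and f: "elementary_map L M N f"
    and dom: "Domain f = universe M" and ran: "Range f = universe N"
  shows "isomorphic L M N"
proof -
  have sub: "f \<subseteq> universe M \<times> universe N"
    using f by (simp add: elementary_map_def)
  obtain a0 where a0: "a0 \<in> universe M"
    using M by (auto simp: structure_of_def)
  obtain b0 where b0: "b0 \<in> universe N"
    using N by (auto simp: structure_of_def)
  have eq: "a = a' \<longleftrightarrow> b = b'" if "(a, b) \<in> f" "(a', b') \<in> f" for a b a' b'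
  proof -
    have "sat M (\<lambda>n. if n = 0 then a else a') (Eql (Var 0) (Var 1)) =
        sat N (\<lambda>n. if n = 0 then b else b') (Eql (Var 0) (Var 1))"
      by (rule elementary_mapD[OF f]) (use that sub in auto)
    then show ?thesis by simp
  qed
  have "\<forall>a. \<exists>b. a \<in> universe M \<longrightarrow> (a, b) \<in> f"
    using dom by blast
  from choice[OF this] obtain h where h: "\<And>a. a \<in> universe M \<Longrightarrow> (a, h a) \<in> f"
    by blast
  have h_unique: "b = h a" if "(a, b) \<in> f" for a b
    using eq[OF that h[of a]] sub that by blast
  define vl where "vl xs n = (if n < length xs then xs ! n else a0)" for xs n
  define wl where "wl xs n = (if n < length xs then map h xs ! n else b0)" for xs n
  have hN: "h a \<in> universe N" if "a \<in> universe M" for a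
    using h[OF that] sub by blast
  have vl: "range (vl xs) \<subseteq> universe M" and wl: "range (wl xs) \<subseteq> universe N"
    and vwl: "n < length xs \<Longrightarrow> (vl xs n, wl xs n) \<in> f"
    if "xs \<in> args (universe M) k" for xs k n
    using that a0 b0 h hN by (auto simp: vl_def wl_def args_def subset_iff)
  have map_vl: "map (eval_trm M (vl xs)) (map Var [0..<length xs]) = xs" for xs
    by (rule nth_equalityI) (auto simp: vl_def)
  have map_wl: "map (eval_trm N (wl xs)) (map Var [0..<length xs]) = map h xs" for xs
    by (rule nth_equalityI) (auto simp: wl_def)
  have "bij_betw h (universe M) (universe N)"
    unfolding bij_betw_def
  proof
    show "inj_on h (universe M)"
      using eq[OF h h] by (auto simp: inj_on_def)
    show "h ` universe M = universe N"
      using hN ran h_unique sub by (fastforce simp: image_iff)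
  qed
  moreover have "h (fun_int M c xs) = fun_int N c (map h xs)"
    if c: "c \<in> Funs L" and xs: "xs \<in> args (universe M) (fun_arity L c)" for c xs
  proof -
    define y where "y = fun_int M c xs"
    have y: "y \<in> universe M"
      using M c xs by (auto simp: structure_of_def y_def)
    define p where "p = (Eql (Var (length xs)) (Fn c (map Var [0..<length xs])) :: ('a, 'b) form)"
    have fresh: "map (eval_trm K (v(length xs := z))) (map Var [0..<length xs]) =
        map (eval_trm K v) (map Var [0..<length xs])" for K :: "('a, 'b, 'k) struct" and v z
      by auto
    have "sat M ((vl xs)(length xs := y)) p = sat N ((wl xs)(length xs := h y)) p"
    proof (rule elementary_mapD[OF f])
      show "form_of L p"
        using c xs by (auto simp: p_def args_def)
      show "range ((vl xs)(length xs := y)) \<subseteq> universe M"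
        using vl[OF xs] y by auto
      show "range ((wl xs)(length xs := h y)) \<subseteq> universe N"
        using wl[OF xs] hN[OF y] by auto
      show "(((vl xs)(length xs := y)) n, ((wl xs)(length xs := h y)) n) \<in> f"
        if "n \<in> free_vars p" for n
        using that vwl[OF xs] h[OF y] by (auto simp: p_def)
    qed
    then show ?thesis
      unfolding p_def sat.simps eval_trm.simps fresh map_vl map_wl by (simp add: y_def)
  qed
  moreover have "rel_int M r xs \<longleftrightarrow> rel_int N r (map h xs)"
    if r: "r \<in> Rels L" and xs: "xs \<in> args (universe M) (rel_arity L r)" for r xs
  proof -
    have "sat M (vl xs) (Rel r (map Var [0..<length xs])) =
        sat N (wl xs) (Rel r (map Var [0..<length xs]))"
      by (rule elementary_mapD[OF f _ vl[OF xs] wl[OF xs]])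
        (use r xs vwl[OF xs] in \<open>auto simp: args_def\<close>)
    then show ?thesis
      unfolding sat.simps map_vl map_wl .
  qed
  ultimately show ?thesis
    unfolding isomorphic_def by blast
qed

lemma countable_underS_cardSuc_natLeq:
  assumes "i \<in> Field (cardSuc natLeq)"
  shows "countable (underS (cardSuc natLeq) i)"
proof -
  have "|underS (cardSuc natLeq) i| <o cardSuc natLeq"
    using assms by (intro card_of_underS cardSuc_Card_order natLeq_Card_order)
  then have "|underS (cardSuc natLeq) i| \<le>o natLeq"
    using cardSuc_ordLeq_ordLess[OF natLeq_Card_order card_of_Card_order] by blast
  then show ?thesis
    by (simp add: countable_card_le_natLeq)
qed

theorem saturated_isomorphic:
  assumes M: "structure_of L M" and N: "structure_of L N"
    and equ: "elementarily_equivalent L M N" and satM: "saturated L M" and satN: "saturated L N"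
    and cM: "|universe M| \<le>o cardSuc natLeq" and cN: "|universe N| \<le>o cardSuc natLeq"
  shows "isomorphic L M N"
proof -
  define R where "R = cardSuc natLeq"
  have wo: "Well_order R"
    using cardSuc_Card_order[OF natLeq_Card_order] by (simp add: R_def card_order_on_def)
  have enum: "\<exists>\<alpha>. \<alpha> ` Field R = A" if "A \<noteq> {}" "|A| \<le>o R" for A :: "'k set"
  proof -
    have "|A| \<le>o |Field R|"
      using that(2) card_of_Field_ordIso[OF cardSuc_Card_order[OF natLeq_Card_order]]
      unfolding R_def using ordIso_symmetric ordLeq_ordIso_trans by blast
    with that(1) show ?thesis
      by (simp add: card_of_ordLeq2)
  qed
  obtain \<alpha> where \<alpha>: "\<alpha> ` Field R = universe M"
    using enum[of "universe M"] M cM by (auto simp: structure_of_def R_def)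
  obtain \<beta> where \<beta>: "\<beta> ` Field R = universe N"
    using enum[of "universe N"] N cN by (auto simp: structure_of_def R_def)
  define good where "good i g \<longleftrightarrow> elementary_map L M N g \<and> countable g \<and>
    \<alpha> i \<in> Domain g \<and> \<beta> i \<in> Range g" for i g
  define H where "H h i = (SOME g. (\<Union>j \<in> underS R i. h j) \<subseteq> g \<and> good i g)"
    for h :: "nat set \<Rightarrow> _" and i
  define F where "F = wfrec (R - Id) H"
  have wf: "wf (R - Id)"
    using wo by (simp add: well_order_on_def)
  have F_unfold: "F i = H F i" for i
  proof -
    have "F i = H (cut F (R - Id) i) i"
      unfolding F_def by (rule wfrec[OF wf])
    also have "\<dots> = H F i"
      unfolding H_def by (simp add: cut_def underS_def)
    finally show ?thesis .
  qed
  have F: "i \<in> Field R \<longrightarrow> good i (F i) \<and> (\<forall>j \<in> underS R i. F j \<subseteq> F i)" for i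
    using wf
  proof (induction i rule: wf_induct_rule)
    case (less i)
    show ?case
    proof
      assume i: "i \<in> Field R"
      have IH: "good j (F j) \<and> (\<forall>k \<in> underS R j. F k \<subseteq> F j)" if "j \<in> underS R i" for j
        using less[of j] that by (auto simp: underS_def Field_def)
      let ?G = "\<Union>j \<in> underS R i. F j"
      have "elementary_map L M N ?G"
      proof (cases "underS R i = {}")
        case True
        then show ?thesis using elementary_map_empty[OF equ] by simp
      next
        case False
        show ?thesis
        proof (rule elementary_map_Union)
          fix f
          assume "f \<in> F ` underS R i"
          then show "elementary_map L M N f"
            using IH by (auto simp: good_def)
        next
          fix f g
          assume "f \<in> F ` underS R i" "g \<in> F ` underS R i"
          then obtain j k where jk: "j \<in> underS R i" "k \<in> underS R i" "f = F j" "g = F k"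
            by blast
          then have "j \<in> Field R" "k \<in> Field R"
            by (auto simp: underS_def Field_def)
          then have "j = k \<or> j \<in> underS R k \<or> k \<in> underS R j"
            using wo by (auto simp: well_order_on_def linear_order_on_def total_on_def underS_def)
          then show "f \<subseteq> g \<or> g \<subseteq> f"
            using IH jk by blast
        qed (use False in simp)
      qed
      moreover have "countable ?G"
        using countable_underS_cardSuc_natLeq[of i] i IH
        by (intro countable_UN) (auto simp: R_def good_def)
      moreover have "\<alpha> i \<in> universe M" "\<beta> i \<in> universe N"
        using \<alpha> \<beta> i by auto
      ultimately have "\<exists>g. ?G \<subseteq> g \<and> good i g"
        unfolding good_def by (intro elementary_map_extend_both satM satN)
      from someI_ex[OF this] have "?G \<subseteq> F i \<and> good i (F i)"
        by (simp only: F_unfold[of i] H_def)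
      then show "good i (F i) \<and> (\<forall>j \<in> underS R i. F j \<subseteq> F i)"
        by blast
    qed
  qed
  have "elementary_map L M N (\<Union>(F ` Field R))"
  proof (rule elementary_map_Union)
    show "F ` Field R \<noteq> {}"
      using \<alpha> M by (auto simp: structure_of_def)
  next
    fix f
    assume "f \<in> F ` Field R"
    then show "elementary_map L M N f"
      using F by (auto simp: good_def)
  next
    fix f g
    assume "f \<in> F ` Field R" "g \<in> F ` Field R"
    then obtain j k where jk: "j \<in> Field R" "k \<in> Field R" "f = F j" "g = F k"
      by blast
    then have "j = k \<or> j \<in> underS R k \<or> k \<in> underS R j"
      using wo by (auto simp: well_order_on_def linear_order_on_def total_on_def underS_def)
    then show "f \<subseteq> g \<or> g \<subseteq> f"
      using F jk by blast
  qed
  moreover from this have "Domain (\<Union>(F ` Field R)) \<subseteq> universe M"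
    "Range (\<Union>(F ` Field R)) \<subseteq> universe N"
    unfolding elementary_map_def by blast+
  moreover have "\<alpha> i \<in> Domain (\<Union>(F ` Field R))" "\<beta> i \<in> Range (\<Union>(F ` Field R))"
    if "i \<in> Field R" for i
    using F[of i] that by (auto simp: good_def)
  then have "universe M \<subseteq> Domain (\<Union>(F ` Field R))" "universe N \<subseteq> Range (\<Union>(F ` Field R))"
    unfolding \<alpha>[symmetric] \<beta>[symmetric] by (auto simp del: Domain_Union Range_Union)
  ultimately show ?thesis
    by (intro elementary_map_total_imp_isomorphic[OF M N]) (auto simp del: Domain_Union Range_Union)
qed

lemma continuum_eq: "continuum = |UNIV :: (nat \<Rightarrow> bool) set|"
  by (simp add: cexp_def ctwo_def Field_natLeq Func_def Field_card_of)

lemma card_universe_ultrapower: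
  fixes U :: "nat filter"
  assumes "|universe M| \<le>o continuum"
  shows "|universe (ultrapower M U)| \<le>o continuum"
proof -
  obtain f :: "_ \<Rightarrow> nat \<Rightarrow> bool" where f: "inj_on f (universe M)"
    using assms unfolding continuum_eq card_of_ordLeq[symmetric] by auto
  define F where "F g n = (case prod_decode n of (i, j) \<Rightarrow> f (g i) j)" for g :: "nat \<Rightarrow> _" and n
  let ?G = "{g. range g \<subseteq> universe M} :: (nat \<Rightarrow> _) set"
  have "inj_on F ?G"
  proof (rule inj_onI, rule ext)
    fix g h i
    assume gh: "g \<in> ?G" "h \<in> ?G" "F g = F h"
    have "f (g i) j = f (h i) j" for j
      using fun_cong[OF gh(3), of "prod_encode (i, j)"] by (simp add: F_def)
    then have "f (g i) = f (h i)"
      by (rule ext)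
    with f show "g i = h i"
      using gh(1,2) by (auto dest!: inj_onD)
  qed
  then have "|?G| \<le>o continuum"
    unfolding continuum_eq card_of_ordLeq[symmetric] by auto
  moreover have "universe (ultrapower M U) = (\<lambda>g. eq_mod U (universe M) `` {g}) ` ?G"
    by (auto simp: ultrapower_def quotient_def)
  ultimately show ?thesis
    using card_of_image ordLeq_transitive by metis
qed

theorem continuum_hypothesis_imp_keisler_criterion:
  assumes CH: continuum_hypothesis
  shows "keisler_criterion TYPE('f) TYPE('r) TYPE('a) TYPE('b)"
  unfolding keisler_criterion_def
proof (intro allI impI)
  fix L :: "('f, 'r) language" and M :: "('f, 'r, 'a) struct" and N :: "('f, 'r, 'b) struct"
  assume L: "countable_language L" and M: "structure_of L M" and N: "structure_of L N"
    and cM: "|universe M| \<le>o continuum" and cN: "|universe N| \<le>o continuum"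
  show "elementarily_equivalent L M N \<longleftrightarrow>
    (\<exists>U :: nat filter. ultrafilter U \<and> isomorphic L (ultrapower M U) (ultrapower N U))"
  proof
    assume equ: "elementarily_equivalent L M N"
    obtain U :: "nat filter" where U: "ultrafilter U" "U \<le> sequentially"
      using ultrafilter_exists[OF sequentially_bot] .
    have "isomorphic L (ultrapower M U) (ultrapower N U)"
    proof (rule saturated_isomorphic)
      show "elementarily_equivalent L (ultrapower M U) (ultrapower N U)"
        using equ elementarily_equivalent_ultrapower[OF U(1) M]
          elementarily_equivalent_ultrapower[OF U(1) N]
          elementarily_equivalent_sym elementarily_equivalent_trans by metis
      show "|universe (ultrapower M U)| \<le>o cardSuc natLeq"
        using card_universe_ultrapower[OF cM] CH ordLeq_ordIso_trans
        unfolding continuum_hypothesis_def by blast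
      show "|universe (ultrapower N U)| \<le>o cardSuc natLeq"
        using card_universe_ultrapower[OF cN] CH ordLeq_ordIso_trans
        unfolding continuum_hypothesis_def by blast
    qed (intro structure_of_ultrapower saturated_ultrapower U L M N)+
    with U(1) show "\<exists>U :: nat filter. ultrafilter U \<and>
        isomorphic L (ultrapower M U) (ultrapower N U)"
      by blast
  next
    assume "\<exists>U :: nat filter. ultrafilter U \<and> isomorphic L (ultrapower M U) (ultrapower N U)"
    then show "elementarily_equivalent L M N"
      using isomorphic_ultrapowers_imp_elementarily_equivalent M N by blast
  qed
qed

section \<open>Dense linear orders of prescribed cofinality\<close>

definition dense_order :: "'a set \<Rightarrow> ('a \<Rightarrow> 'a \<Rightarrow> bool) \<Rightarrow> bool" where
  "dense_order A lt \<longleftrightarrow> A \<noteq> {} \<and> (\<forall>x \<in> A. \<not> lt x x) \<and>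
     (\<forall>x \<in> A. \<forall>y \<in> A. \<forall>z \<in> A. lt x y \<longrightarrow> lt y z \<longrightarrow> lt x z) \<and>
     (\<forall>x \<in> A. \<forall>y \<in> A. x = y \<or> lt x y \<or> lt y x) \<and>
     (\<forall>x \<in> A. \<forall>y \<in> A. lt x y \<longrightarrow> (\<exists>z \<in> A. lt x z \<and> lt z y)) \<and>
     (\<forall>x \<in> A. \<exists>y \<in> A. lt x y) \<and> (\<forall>x \<in> A. \<exists>y \<in> A. lt y x)"

lemma
  assumes A: "dense_order A lt"
  shows dense_order_nonempty: "A \<noteq> {}"
    and dense_order_irrefl: "x \<in> A \<Longrightarrow> \<not> lt x x"
    and dense_order_trans: "lt x y \<Longrightarrow> lt y z \<Longrightarrow> x \<in> A \<Longrightarrow> y \<in> A \<Longrightarrow> z \<in> A \<Longrightarrow> lt x z"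
    and dense_order_total: "x \<in> A \<Longrightarrow> y \<in> A \<Longrightarrow> x = y \<or> lt x y \<or> lt y x"
    and dense_order_dense: "x \<in> A \<Longrightarrow> y \<in> A \<Longrightarrow> lt x y \<Longrightarrow> \<exists>z \<in> A. lt x z \<and> lt z y"
    and dense_order_no_max: "x \<in> A \<Longrightarrow> \<exists>y \<in> A. lt x y"
    and dense_order_no_min: "x \<in> A \<Longrightarrow> \<exists>y \<in> A. lt y x"
proof -
  have *: "A \<noteq> {}" "\<forall>x \<in> A. \<not> lt x x"
    "\<forall>x \<in> A. \<forall>y \<in> A. \<forall>z \<in> A. lt x y \<longrightarrow> lt y z \<longrightarrow> lt x z"
    "\<forall>x \<in> A. \<forall>y \<in> A. x = y \<or> lt x y \<or> lt y x"
    "\<forall>x \<in> A. \<forall>y \<in> A. lt x y \<longrightarrow> (\<exists>z \<in> A. lt x z \<and> lt z y)"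
    "\<forall>x \<in> A. \<exists>y \<in> A. lt x y" "\<forall>x \<in> A. \<exists>y \<in> A. lt y x"
    using A unfolding dense_order_def by - (elim conjE, assumption)+
  show "A \<noteq> {}" by (rule *(1))
  show "\<not> lt x x" if "x \<in> A" using *(2) that by (rule bspec)
  show "lt x z" if "lt x y" "lt y z" "x \<in> A" "y \<in> A" "z \<in> A"
    using *(3)[rule_format, OF that(3,4,5,1,2)] .
  show "x = y \<or> lt x y \<or> lt y x" if "x \<in> A" "y \<in> A"
    using *(4)[rule_format, OF that] .
  show "\<exists>z \<in> A. lt x z \<and> lt z y" if "x \<in> A" "y \<in> A" "lt x y"
    using *(5)[rule_format, OF that] .
  show "\<exists>y \<in> A. lt x y" "\<exists>y \<in> A. lt y x" if "x \<in> A"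
    using *(6,7) that by auto
qed

lemma dense_order_le_less_trans:
  assumes "dense_order A lt" "x = y \<or> lt x y" "lt y z" "x \<in> A" "y \<in> A" "z \<in> A"
  shows "lt x z"
  using assms(2)
proof
  assume "x = y"
  then show ?thesis using assms(3) by simp
next
  assume "lt x y"
  then show ?thesis by (rule dense_order_trans[OF assms(1) _ assms(3-6)])
qed

lemma dense_order_dual:
  assumes A: "dense_order A lt"
  shows "dense_order A (\<lambda>x y. lt y x)"
  unfolding dense_order_def
proof (intro conjI ballI impI)
  show "A \<noteq> {}" by (rule dense_order_nonempty[OF A])
  fix x
  assume x: "x \<in> A"
  show "\<not> lt x x" by (rule dense_order_irrefl[OF A x])
  show "\<exists>y \<in> A. lt y x" "\<exists>y \<in> A. lt x y"
    using dense_order_no_max[OF A x] dense_order_no_min[OF A x] by auto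
  fix y
  assume y: "y \<in> A"
  show "x = y \<or> lt y x \<or> lt x y"
    using dense_order_total[OF A x y] by auto
  show "\<exists>z \<in> A. lt z x \<and> lt y z" if "lt y x"
    using dense_order_dense[OF A y x that] by auto
  show "lt z x" if "z \<in> A" "lt y x" "lt z y" for z
    using dense_order_trans[OF A that(3,2,1) y x] .
qed

lemma dense_order_Max:
  assumes "dense_order A lt" "finite X" "X \<noteq> {}" "X \<subseteq> A"
  shows "\<exists>m \<in> X. \<forall>x \<in> X. x = m \<or> lt x m"
  using assms(2-4)
proof (induction X rule: finite_ne_induct)
  case (insert x X)
  then obtain m where m: "m \<in> X" "\<forall>y \<in> X. y = m \<or> lt y m"
    by auto
  have "x \<in> A" "m \<in> A" "X \<subseteq> A"
    using insert.prems m by auto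
  then consider "x = m \<or> lt x m" | "lt m x"
    using dense_order_total[OF assms(1) \<open>x \<in> A\<close> \<open>m \<in> A\<close>] by auto
  then show ?case
  proof cases
    case 1
    then show ?thesis using m by (intro bexI[of _ m]) auto
  next
    case 2
    have "lt y x" if "y \<in> X" for y
      by (rule dense_order_le_less_trans[OF assms(1) _ 2 _ \<open>m \<in> A\<close> \<open>x \<in> A\<close>])
        (use m(2) that \<open>X \<subseteq> A\<close> in auto)
    then show ?thesis by (intro bexI[of _ x]) auto
  qed
qed simp

lemma dense_order_above:
  assumes A: "dense_order A lt" and X: "finite X" "X \<subseteq> A"
  shows "\<exists>b \<in> A. \<forall>x \<in> X. lt x b"
proof (cases "X = {}")
  case True
  then show ?thesis using dense_order_nonempty[OF A] by auto
next
  case False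
  obtain m where m: "m \<in> X" "\<forall>x \<in> X. x = m \<or> lt x m"
    using dense_order_Max[OF A X(1) False X(2)] by (rule bexE)
  then have mA: "m \<in> A" using X by blast
  obtain b where b: "b \<in> A" "lt m b"
    using dense_order_no_max[OF A mA] by (rule bexE)
  have "lt x b" if "x \<in> X" for x
    by (rule dense_order_le_less_trans[OF A _ b(2) _ mA b(1)]) (use m(2) that X(2) in auto)
  with b(1) show ?thesis by (intro bexI ballI)
qed

lemma dense_order_between:
  assumes A: "dense_order A lt" and X: "finite X" "X \<subseteq> A" and Y: "finite Y" "Y \<subseteq> A"
    and lt: "\<forall>x \<in> X. \<forall>y \<in> Y. lt x y"
  shows "\<exists>b \<in> A. (\<forall>x \<in> X. lt x b) \<and> (\<forall>y \<in> Y. lt b y)"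
proof -
  consider "X = {}" | "Y = {}" | "X \<noteq> {}" "Y \<noteq> {}" by blast
  then show ?thesis
  proof cases
    case 1
    then show ?thesis
      using dense_order_above[OF dense_order_dual[OF A] Y] by simp
  next
    case 2
    then show ?thesis
      using dense_order_above[OF A X] by simp
  next
    case 3
    obtain m where m: "m \<in> X" "\<forall>x \<in> X. x = m \<or> lt x m"
      using dense_order_Max[OF A X(1) 3(1) X(2)] by (rule bexE)
    obtain n where n: "n \<in> Y" "\<forall>y \<in> Y. y = n \<or> lt n y"
      using dense_order_Max[OF dense_order_dual[OF A] Y(1) 3(2) Y(2)] by (rule bexE)
    have mn: "m \<in> A" "n \<in> A" "lt m n"
      using m n X Y lt by auto
    obtain b where b: "b \<in> A" "lt m b" "lt b n"
      using dense_order_dense[OF A mn] by auto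
    have "lt x b" if "x \<in> X" for x
      by (rule dense_order_le_less_trans[OF A _ b(2) _ mn(1) b(1)]) (use m(2) that X(2) in auto)
    moreover have "lt b y" if "y \<in> Y" for y
      by (rule dense_order_le_less_trans[OF dense_order_dual[OF A] _ b(3) _ mn(2) b(1)])
        (use n(2) that Y(2) in auto)
    ultimately show ?thesis using b(1) by (intro bexI conjI ballI)
  qed
qed

definition order_language :: "'r \<Rightarrow> ('f, 'r) language" where
  "order_language r = \<lparr>Funs = {}, Rels = {r}, fun_arity = (\<lambda>_. 0), rel_arity = (\<lambda>_. 2)\<rparr>"

definition order_struct :: "'a set \<Rightarrow> ('a \<Rightarrow> 'a \<Rightarrow> bool) \<Rightarrow> ('f, 'r, 'a) struct" where
  "order_struct A lt =
     \<lparr>universe = A, fun_int = undefined, rel_int = (\<lambda>_ xs. lt (xs ! 0) (xs ! 1))\<rparr>"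

lemma countable_order_language: "countable_language (order_language r)"
  by (simp add: countable_language_def order_language_def)

lemma structure_of_order_struct: "A \<noteq> {} \<Longrightarrow> structure_of (order_language r) (order_struct A lt)"
  by (simp add: structure_of_def order_language_def order_struct_def)

lemma universe_order_struct [simp]: "universe (order_struct A lt) = A"
  by (simp add: order_struct_def)

lemma trm_of_order_language: "trm_of (order_language r) t \<longleftrightarrow> (\<exists>n. t = Var n)"
  by (cases t) (auto simp: order_language_def)

lemma sat_dense_order:
  assumes A: "dense_order A lt" and B: "dense_order B lt'"
    and p: "form_of (order_language r) p" and v: "range v \<subseteq> A" and w: "range w \<subseteq> B"
    and vw: "\<forall>m \<in> free_vars p. \<forall>n \<in> free_vars p.
      (v m = v n \<longleftrightarrow> w m = w n) \<and> (lt (v m) (v n) \<longleftrightarrow> lt' (w m) (w n))"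
  shows "sat (order_struct A lt) v p = sat (order_struct B lt') w p"
  using p v w vw
proof (induction p arbitrary: v w)
  case (Eql s t)
  then obtain m n where "s = Var m" "t = Var n"
    by (auto simp: trm_of_order_language)
  with Eql show ?case by auto
next
  case (Rel q ts)
  have "length ts = 2" "\<forall>t \<in> set ts. \<exists>n. t = Var n"
    using Rel by (auto simp: trm_of_order_language) (auto simp: order_language_def)
  then obtain m n where "ts = [Var m, Var n]"
    by (auto simp: numeral_2_eq_2 length_Suc_conv)
  with Rel show ?case by (auto simp: order_struct_def)
next
  case (Imp p q)
  have "sat (order_struct A lt) v p = sat (order_struct B lt') w p"
    by (rule Imp.IH) (use Imp.prems in auto)
  moreover have "sat (order_struct A lt) v q = sat (order_struct B lt') w q"
    by (rule Imp.IH) (use Imp.prems in auto)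
  ultimately show ?case by simp
next
  case (All x p)
  let ?F = "free_vars p - {x}"
  have ext: "\<exists>b \<in> B'. \<forall>n \<in> ?F. (a = v' n \<longleftrightarrow> b = w' n) \<and>
      (l a (v' n) \<longleftrightarrow> l' b (w' n)) \<and> (l (v' n) a \<longleftrightarrow> l' (w' n) b)"
    if A': "dense_order A' l" and B': "dense_order B' l'" and v': "range v' \<subseteq> A'" and w': "range w' \<subseteq> B'"
      and vw': "\<forall>m \<in> ?F. \<forall>n \<in> ?F.
        (v' m = v' n \<longleftrightarrow> w' m = w' n) \<and> (l (v' m) (v' n) \<longleftrightarrow> l' (w' m) (w' n))"
      and a: "a \<in> A'"
    for A' :: "'k set" and B' :: "'l set" and l l' v' w' a
  proof (cases "\<exists>m \<in> ?F. a = v' m")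
    case True
    then obtain m where m: "m \<in> ?F" "a = v' m" by blast
    then have "w' m \<in> B'" using w' by auto
    with m vw' show ?thesis by (intro bexI[of _ "w' m"]) auto
  next
    case False
    let ?X = "{n \<in> ?F. l (v' n) a}" and ?Y = "{n \<in> ?F. l a (v' n)}"
    have vA: "v' n \<in> A'" and wB: "w' n \<in> B'" for n
      using v' w' by auto
    note irr = dense_order_irrefl[OF B'] and irrA = dense_order_irrefl[OF A']
      and tr = dense_order_trans[OF A'] and tr' = dense_order_trans[OF B']
    have tot: "l a (v' n) \<or> l (v' n) a" if "n \<in> ?F" for n
    proof -
      have "a = v' n \<or> l a (v' n) \<or> l (v' n) a"
        by (rule dense_order_total[OF A' a vA])
      with False that show ?thesis by auto
    qed
    have fin: "finite (w' ` ?X)" "finite (w' ` ?Y)"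
      using finite_free_vars[of p] by auto
    have sub: "w' ` ?X \<subseteq> B'" "w' ` ?Y \<subseteq> B'"
      using wB by auto
    have "l' (w' m) (w' n)" if "m \<in> ?X" "n \<in> ?Y" for m n
    proof -
      have "l (v' m) (v' n)"
        using that tr[of "v' m" a "v' n"] vA a by simp
      then show ?thesis using vw' that by simp
    qed
    then have "\<forall>x \<in> w' ` ?X. \<forall>y \<in> w' ` ?Y. l' x y"
      by simp
    from dense_order_between[OF B' fin(1) sub(1) fin(2) sub(2) this]
    obtain b where b: "b \<in> B'" "\<forall>x \<in> w' ` ?X. l' x b" "\<forall>y \<in> w' ` ?Y. l' b y"
      by (elim bexE conjE)
    have "(a = v' n \<longleftrightarrow> b = w' n) \<and> (l a (v' n) \<longleftrightarrow> l' b (w' n)) \<and> (l (v' n) a \<longleftrightarrow> l' (w' n) b)"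
      if n: "n \<in> ?F" for n
    proof (cases "l a (v' n)")
      case True
      then have "\<not> l (v' n) a"
        using tr[OF _ _ a vA a] irrA[OF a] by auto
      moreover have "l' b (w' n)"
        using b(3) n True by simp
      moreover from this have "\<not> l' (w' n) b" "b \<noteq> w' n"
        using tr'[OF _ _ b(1) wB b(1)] irr[OF b(1)] by auto
      moreover have "a \<noteq> v' n"
        using False n by simp
      ultimately show ?thesis using True by simp
    next
      case nl: False
      then have "l (v' n) a"
        using tot[OF n] by simp
      moreover from this have "l' (w' n) b"
        using b(2) n by simp
      moreover from this have "\<not> l' b (w' n)" "b \<noteq> w' n"
        using tr'[OF _ _ b(1) wB b(1)] irr[OF b(1)] by auto
      moreover have "a \<noteq> v' n"
        using False n by simp
      ultimately show ?thesis using nl by simp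
    qed
    with b(1) show ?thesis by (intro bexI[of _ b] ballI)
  qed
  have step: "sat (order_struct A lt) (v(x := a)) p = sat (order_struct B lt') (w(x := b)) p"
    if a: "a \<in> A" and b: "b \<in> B" and ab: "\<forall>n \<in> ?F. (a = v n \<longleftrightarrow> b = w n) \<and>
      (lt a (v n) \<longleftrightarrow> lt' b (w n)) \<and> (lt (v n) a \<longleftrightarrow> lt' (w n) b)" for a b
  proof (rule All.IH)
    have irr: "\<not> lt a a" "\<not> lt' b b"
      using dense_order_irrefl[OF A a] dense_order_irrefl[OF B b] by auto
    have "(v(x := a)) m = (v(x := a)) n \<longleftrightarrow> (w(x := b)) m = (w(x := b)) n"
      "lt ((v(x := a)) m) ((v(x := a)) n) \<longleftrightarrow> lt' ((w(x := b)) m) ((w(x := b)) n)"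
      if mn: "m \<in> free_vars p" "n \<in> free_vars p" for m n
    proof -
      show "(v(x := a)) m = (v(x := a)) n \<longleftrightarrow> (w(x := b)) m = (w(x := b)) n"
        using mn ab All.prems(4) by (cases "m = x"; cases "n = x") (auto simp: eq_commute)
      show "lt ((v(x := a)) m) ((v(x := a)) n) \<longleftrightarrow> lt' ((w(x := b)) m) ((w(x := b)) n)"
        using mn ab irr All.prems(4) by (cases "m = x"; cases "n = x") auto
    qed
    then show "\<forall>m \<in> free_vars p. \<forall>n \<in> free_vars p.
        ((v(x := a)) m = (v(x := a)) n \<longleftrightarrow> (w(x := b)) m = (w(x := b)) n) \<and>
        (lt ((v(x := a)) m) ((v(x := a)) n) \<longleftrightarrow> lt' ((w(x := b)) m) ((w(x := b)) n))"
      by simp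
  qed (use All.prems a b in auto)
  have vw: "\<forall>m \<in> ?F. \<forall>n \<in> ?F. (v m = v n \<longleftrightarrow> w m = w n) \<and> (lt (v m) (v n) \<longleftrightarrow> lt' (w m) (w n))"
    using All.prems(4) by simp
  then have wv: "\<forall>m \<in> ?F. \<forall>n \<in> ?F. (w m = w n \<longleftrightarrow> v m = v n) \<and> (lt' (w m) (w n) \<longleftrightarrow> lt (v m) (v n))"
    by simp
  show ?case
    unfolding sat.simps universe_order_struct
  proof (intro iffI ballI)
    fix b
    assume *: "\<forall>a \<in> A. sat (order_struct A lt) (v(x := a)) p" and b: "b \<in> B"
    obtain a where a: "a \<in> A" "\<forall>n \<in> ?F. (b = w n \<longleftrightarrow> a = v n) \<and>
      (lt' b (w n) \<longleftrightarrow> lt a (v n)) \<and> (lt' (w n) b \<longleftrightarrow> lt (v n) a)"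
      using ext[OF B A All.prems(3,2) wv b] by (rule bexE)
    show "sat (order_struct B lt') (w(x := b)) p"
      using step[OF a(1) b] a * by simp
  next
    fix a
    assume *: "\<forall>b \<in> B. sat (order_struct B lt') (w(x := b)) p" and a: "a \<in> A"
    obtain b where b: "b \<in> B" "\<forall>n \<in> ?F. (a = v n \<longleftrightarrow> b = w n) \<and>
      (lt a (v n) \<longleftrightarrow> lt' b (w n)) \<and> (lt (v n) a \<longleftrightarrow> lt' (w n) b)"
      using ext[OF A B All.prems(2,3) vw a] by (rule bexE)
    show "sat (order_struct A lt) (v(x := a)) p"
      using step[OF a b(1)] b * by simp
  qed
qed simp

lemma elementarily_equivalent_dense_orders:
  assumes A: "dense_order A lt" and B: "dense_order B lt'"
  shows "elementarily_equivalent (order_language r) (order_struct A lt) (order_struct B lt')"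
  unfolding elementarily_equivalent_def
proof (intro allI impI)
  fix p
  assume p: "sentence_of (order_language r) p"
  obtain a b where a: "a \<in> A" and b: "b \<in> B"
    using dense_order_nonempty[OF A] dense_order_nonempty[OF B] by auto
  have va: "range (\<lambda>_. a) \<subseteq> universe (order_struct A lt)"
    and wb: "range (\<lambda>_. b) \<subseteq> universe (order_struct B lt')"
    using a b by auto
  have "sat (order_struct A lt) (\<lambda>_. a) p = sat (order_struct B lt') (\<lambda>_. b) p"
    by (rule sat_dense_order[OF A B]) (use p a b in \<open>auto simp: sentence_of_def\<close>)
  then show "models (order_struct A lt) p \<longleftrightarrow> models (order_struct B lt') p"
    using models_sentence[OF p va] models_sentence[OF p wb] by simp
qed

lemma dense_order_image:
  assumes \<phi>: "inj_on \<phi> S" and S: "dense_order S lt"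
  shows "dense_order (\<phi> ` S) (\<lambda>x y. lt (inv_into S \<phi> x) (inv_into S \<phi> y))"
proof -
  have inv: "inv_into S \<phi> (\<phi> x) = x" if "x \<in> S" for x
    using \<phi> that by (rule inv_into_f_f)
  show ?thesis
    unfolding dense_order_def ball_simps bex_simps
  proof (intro conjI ballI impI)
    show "\<phi> ` S \<noteq> {}"
      using dense_order_nonempty[OF S] by simp
    fix x
    assume x: "x \<in> S"
    show "\<not> lt (inv_into S \<phi> (\<phi> x)) (inv_into S \<phi> (\<phi> x))"
      using dense_order_irrefl[OF S x] by (simp add: inv x)
    obtain y where y: "y \<in> S" "lt x y"
      using dense_order_no_max[OF S x] by (rule bexE)
    then show "\<exists>y \<in> S. lt (inv_into S \<phi> (\<phi> x)) (inv_into S \<phi> (\<phi> y))"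
      by (intro bexI[of _ y]) (simp_all add: inv x)
    obtain z where z: "z \<in> S" "lt z x"
      using dense_order_no_min[OF S x] by (rule bexE)
    then show "\<exists>y \<in> S. lt (inv_into S \<phi> (\<phi> y)) (inv_into S \<phi> (\<phi> x))"
      by (intro bexI[of _ z]) (simp_all add: inv x)
  next
    fix x y
    assume x: "x \<in> S" and y: "y \<in> S"
    show "\<phi> x = \<phi> y \<or> lt (inv_into S \<phi> (\<phi> x)) (inv_into S \<phi> (\<phi> y)) \<or>
        lt (inv_into S \<phi> (\<phi> y)) (inv_into S \<phi> (\<phi> x))"
      using dense_order_total[OF S x y] by (auto simp: inv x y)
  next
    fix x y
    assume x: "x \<in> S" and y: "y \<in> S" and "lt (inv_into S \<phi> (\<phi> x)) (inv_into S \<phi> (\<phi> y))"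
    then have "lt x y"
      by (simp add: inv)
    from dense_order_dense[OF S x y this] obtain z where "z \<in> S" "lt x z" "lt z y"
      by (elim bexE conjE)
    then show "\<exists>z \<in> S. lt (inv_into S \<phi> (\<phi> x)) (inv_into S \<phi> (\<phi> z)) \<and>
        lt (inv_into S \<phi> (\<phi> z)) (inv_into S \<phi> (\<phi> y))"
      by (intro bexI[of _ z]) (simp_all add: inv x y)
  next
    fix x y z
    assume "x \<in> S" "y \<in> S" "z \<in> S" "lt (inv_into S \<phi> (\<phi> x)) (inv_into S \<phi> (\<phi> y))"
      "lt (inv_into S \<phi> (\<phi> y)) (inv_into S \<phi> (\<phi> z))"
    then show "lt (inv_into S \<phi> (\<phi> x)) (inv_into S \<phi> (\<phi> z))"
      using dense_order_trans[OF S, of x y z] by (simp add: inv)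
  qed
qed

fun lex_less :: "'k rel \<Rightarrow> 'k \<times> rat \<Rightarrow> 'k \<times> rat \<Rightarrow> bool" where
  "lex_less k (i, p) (j, q) \<longleftrightarrow> (i, j) \<in> k \<and> i \<noteq> j \<or> i = j \<and> p < q"

lemma dense_order_lex:
  assumes k: "Well_order k" and ne: "Field k \<noteq> {}"
  shows "dense_order (Field k \<times> UNIV) (lex_less k)"
proof -
  have tr: "(a, c) \<in> k" if "(a, b) \<in> k" "(b, c) \<in> k" for a b c
    using k that unfolding well_order_on_def linear_order_on_def partial_order_on_def
      preorder_on_def by (meson transD)
  have asym: "a = b" if "(a, b) \<in> k" "(b, a) \<in> k" for a b
    using k that unfolding well_order_on_def linear_order_on_def partial_order_on_def
    by (meson antisymD)
  have tot: "a = b \<or> (a, b) \<in> k \<or> (b, a) \<in> k" if "a \<in> Field k" "b \<in> Field k" for a b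
    using k that unfolding well_order_on_def linear_order_on_def total_on_def by metis
  show ?thesis
    unfolding dense_order_def split_paired_Ball_Sigma split_paired_Bex_Sigma
  proof (intro conjI ballI impI)
    show "Field k \<times> (UNIV :: rat set) \<noteq> {}"
      using ne by simp
    fix i and p :: rat
    assume i: "i \<in> Field k"
    show "\<not> lex_less k (i, p) (i, p)"
      by simp
    show "\<exists>j \<in> Field k. \<exists>q \<in> UNIV. lex_less k (i, p) (j, q)"
      using i by (intro bexI[of _ i] bexI[of _ "p + 1"]) simp_all
    show "\<exists>j \<in> Field k. \<exists>q \<in> UNIV. lex_less k (j, q) (i, p)"
      using i by (intro bexI[of _ i] bexI[of _ "p - 1"]) simp_all
  next
    fix i j and p q :: rat
    assume ij: "i \<in> Field k" "j \<in> Field k"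
    show "(i, p) = (j, q) \<or> lex_less k (i, p) (j, q) \<or> lex_less k (j, q) (i, p)"
      using tot[OF ij] by (auto simp: not_less_iff_gr_or_eq)
  next
    fix i j and p q :: rat
    assume ij: "i \<in> Field k" "j \<in> Field k" and "lex_less k (i, p) (j, q)"
    then consider "(i, j) \<in> k" "i \<noteq> j" | "i = j" "p < q"
      by auto
    then show "\<exists>l \<in> Field k. \<exists>r \<in> UNIV. lex_less k (i, p) (l, r) \<and> lex_less k (l, r) (j, q)"
    proof cases
      case 1
      then show ?thesis
        using ij by (intro bexI[of _ i] bexI[of _ "p + 1"]) simp_all
    next
      case 2
      then obtain r where "p < r" "r < q"
        using dense by blast
      then show ?thesis
        using 2 ij by (intro bexI[of _ i] bexI[of _ r]) simp_all
    qed
  next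
    fix i j l and p q r :: rat
    assume "lex_less k (i, p) (j, q)" "lex_less k (j, q) (l, r)"
    then show "lex_less k (i, p) (l, r)"
      using tr[of i j l] asym[of i j] by auto
  qed
qed

lemma exists_dense_order:
  fixes r :: "'k rel"
  assumes r: "Card_order r" "infinite (Field r)" and big: "cardSuc r \<le>o |UNIV :: 'a set|"
  obtains A :: "'a set" and lt where "dense_order A lt" "|A| \<le>o cardSuc r"
    "\<And>B. B \<subseteq> A \<Longrightarrow> |B| \<le>o r \<Longrightarrow> \<exists>c \<in> A. \<forall>x \<in> B. lt x c"
proof -
  define k where "k = cardSuc r"
  have k: "Card_order k" "infinite (Field k)"
    using r by (simp_all add: k_def cardSuc_Card_order cardSuc_finite)
  then have wo: "Well_order k"
    by (simp add: card_order_on_def)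
  define S where "S = Field k \<times> (UNIV :: rat set)"
  have "|UNIV :: rat set| \<le>o natLeq"
    by (simp flip: countable_card_le_natLeq)
  moreover have "natLeq \<le>o k"
    using k by (intro natLeq_ordLeq_cinfinite) (simp add: cinfinite_def)
  ultimately have "|UNIV :: rat set| \<le>o k"
    by (rule ordLeq_transitive)
  moreover have "|Field k| \<le>o k"
    using card_of_Field_ordIso[OF k(1)] by (rule ordIso_imp_ordLeq)
  ultimately have Sk: "|S| \<le>o k"
    unfolding S_def using k by (intro card_of_Times_ordLeq_infinite_Field)
  then have "|S| \<le>o |UNIV :: 'a set|"
    using big unfolding k_def by (rule ordLeq_transitive)
  then obtain \<phi> :: "_ \<Rightarrow> 'a" where \<phi>: "inj_on \<phi> S"
    unfolding card_of_ordLeq[symmetric] by auto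
  have S: "dense_order S (lex_less k)"
    unfolding S_def using wo k(2) by (intro dense_order_lex) auto
  define lt where "lt x y = lex_less k (inv_into S \<phi> x) (inv_into S \<phi> y)" for x y
  show thesis
  proof
    show "dense_order (\<phi> ` S) lt"
      unfolding lt_def by (rule dense_order_image[OF \<phi> S])
    show "|\<phi> ` S| \<le>o cardSuc r"
      using card_of_image Sk unfolding k_def by (rule ordLeq_transitive)
    fix B
    assume B: "B \<subseteq> \<phi> ` S" "|B| \<le>o r"
    define I where "I = (fst \<circ> inv_into S \<phi>) ` B"
    have cI: "|I| \<le>o r"
      unfolding I_def using card_of_image B(2) by (rule ordLeq_transitive)
    have inv: "inv_into S \<phi> x \<in> S" if "x \<in> B" for x
      using B(1) that by (intro inv_into_into) auto
    have I: "I \<subseteq> (\<Union>i \<in> Field k. underS k i)"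
    proof
      fix i
      assume "i \<in> I"
      then have "i \<in> Field k"
        using inv by (auto simp: I_def S_def mem_Times_iff)
      from infinite_Card_order_limit[OF k(1,2) this]
      show "i \<in> (\<Union>i \<in> Field k. underS k i)"
        by (auto simp: underS_def)
    qed
    have "relChain k (underS k)"
      unfolding relChain_def
      using underS_incr[OF wo_rel.TRANS wo_rel.ANTISYM] wo unfolding wo_rel_def by metis
    then obtain i where i: "i \<in> Field k" "I \<subseteq> underS k i"
      using cardSuc_UNION[OF r _ _ cI] I unfolding k_def by metis
    have "lt x (\<phi> (i, 0))" if "x \<in> B" for x
    proof -
      obtain j q where jq: "inv_into S \<phi> x = (j, q)"
        by fastforce
      then have "j \<in> I"
        using that by (force simp: I_def)
      then have "j \<in> underS k i"
        using i(2) by auto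
      moreover have "inv_into S \<phi> (\<phi> (i, 0)) = (i, 0)"
        by (rule inv_into_f_f[OF \<phi>]) (simp add: S_def i(1))
      ultimately show ?thesis
        using jq by (simp add: lt_def underS_def)
    qed
    moreover have "\<phi> (i, 0) \<in> \<phi> ` S"
      using i(1) by (simp add: S_def)
    ultimately show "\<exists>c \<in> \<phi> ` S. \<forall>x \<in> B. lt x c"
      by (intro bexI ballI)
  qed
qed

section \<open>Ultrapowers preserve uncountable cofinality\<close>

lemma not_isomorphic_ultrapowers:
  fixes U :: "nat filter"
  assumes U: "U \<noteq> bot" and k: "Card_order k" "infinite (Field k)"
    and A: "|A| \<le>o k" "\<And>X. X \<subseteq> A \<Longrightarrow> |X| \<le>o natLeq \<Longrightarrow> \<exists>c \<in> A. \<forall>x \<in> X. lt x c"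
    and B: "dense_order B lt'" "\<And>Y. Y \<subseteq> B \<Longrightarrow> |Y| \<le>o k \<Longrightarrow> \<exists>c \<in> B. \<forall>y \<in> Y. lt' y c"
  shows "\<not> isomorphic (order_language r)
    (ultrapower (order_struct A lt) U) (ultrapower (order_struct B lt') U)"
    (is "\<not> isomorphic ?L ?M ?N")
proof
  assume "isomorphic ?L ?M ?N"
  then obtain h where bij: "bij_betw h (universe ?M) (universe ?N)"
    and h: "\<And>xs. xs \<in> args (universe ?M) 2 \<Longrightarrow> rel_int ?M r xs \<longleftrightarrow> rel_int ?N r (map h xs)"
    unfolding isomorphic_def by (auto simp: order_language_def)
  have relM: "rel_int ?M r [eq_mod U A `` {f}, eq_mod U A `` {g}] \<longleftrightarrow>
      eventually (\<lambda>i. lt (f i) (g i)) U" if "range f \<subseteq> A" "range g \<subseteq> A" for f g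
    using rel_int_ultrapower[of "[f, g]" "order_struct A lt" U r] that
    by (simp add: order_struct_def)
  have relN: "rel_int ?N r [eq_mod U B `` {f}, eq_mod U B `` {g}] \<longleftrightarrow>
      eventually (\<lambda>i. lt' (f i) (g i)) U" if "range f \<subseteq> B" "range g \<subseteq> B" for f g
    using rel_int_ultrapower[of "[f, g]" "order_struct B lt'" U r] that
    by (simp add: order_struct_def)
  have classM: "eq_mod U A `` {f} \<in> universe ?M" if "range f \<subseteq> A" for f
    using class_in_ultrapower[of f "order_struct A lt" U] that by simp
  have classN: "eq_mod U B `` {f} \<in> universe ?N" if "range f \<subseteq> B" for f
    using class_in_ultrapower[of f "order_struct B lt'" U] that by simp
  have hN: "h X \<in> universe ?N" if "X \<in> universe ?M" for X
    using bij that by (auto simp: bij_betw_def)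
  have "\<forall>a. \<exists>f. a \<in> A \<longrightarrow> range f \<subseteq> B \<and> h (eq_mod U A `` {\<lambda>_. a}) = eq_mod U B `` {f}"
  proof
    fix a
    show "\<exists>f. a \<in> A \<longrightarrow> range f \<subseteq> B \<and> h (eq_mod U A `` {\<lambda>_. a}) = eq_mod U B `` {f}"
    proof (cases "a \<in> A")
      case True
      then have "h (eq_mod U A `` {\<lambda>_. a}) \<in> universe ?N"
        by (intro hN classM) auto
      then show ?thesis
        unfolding universe_ultrapower by simp
    qed simp
  qed
  from choice[OF this] obtain K where K_all:
    "\<forall>a. a \<in> A \<longrightarrow> range (K a) \<subseteq> B \<and> h (eq_mod U A `` {\<lambda>_. a}) = eq_mod U B `` {K a}"
    by (rule exE)
  note K = K_all[rule_format, THEN conjunct1] K_all[rule_format, THEN conjunct2]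
  define Y where "Y = (\<lambda>(a, i). K a i) ` (A \<times> (UNIV :: nat set))"
  have YB: "Y \<subseteq> B"
    using K(1) by (auto simp: Y_def)
  have "|UNIV :: nat set| \<le>o k"
    using k card_of_nat natLeq_ordLeq_cinfinite[of k] ordIso_ordLeq_trans
    unfolding cinfinite_def by blast
  then have "|A \<times> (UNIV :: nat set)| \<le>o k"
    using A(1) k by (intro card_of_Times_ordLeq_infinite_Field)
  then have "|Y| \<le>o k"
    unfolding Y_def by (rule ordLeq_transitive[OF card_of_image])
  from B(2)[OF YB this] obtain b where b: "b \<in> B" "\<forall>y \<in> Y. lt' y b"
    by (rule bexE)
  have "eq_mod U B `` {\<lambda>_. b} \<in> h ` universe ?M"
    using bij classN[of "\<lambda>_. b"] b(1) by (auto simp: bij_betw_def)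
  then obtain X where X: "X \<in> universe ?M" "eq_mod U B `` {\<lambda>_. b} = h X"
    by (elim imageE)
  then obtain g where g: "range g \<subseteq> A" "X = eq_mod U A `` {g}"
    unfolding universe_ultrapower universe_order_struct by (elim exE conjE)
  have "|range g| \<le>o natLeq"
    using countable_card_le_natLeq[of "range g"] by simp
  from A(2)[OF g(1) this] obtain c where c: "c \<in> A" "\<forall>x \<in> range g. lt x c"
    by (rule bexE)
  have cA: "range (\<lambda>_ :: nat. c) \<subseteq> A" and bB: "range (\<lambda>_ :: nat. b) \<subseteq> B"
    using c b by auto
  have "rel_int ?M r [X, eq_mod U A `` {\<lambda>_. c}]"
    unfolding g(2) relM[OF g(1) cA] using c(2) by simp
  then have "rel_int ?N r [h X, h (eq_mod U A `` {\<lambda>_. c})]"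
    using h[of "[X, eq_mod U A `` {\<lambda>_. c}]"] X(1) classM[OF cA] by (simp add: args_def)
  then have "eventually (\<lambda>i. lt' b (K c i)) U"
    unfolding X(2)[symmetric] K(2)[OF c(1)] relN[OF bB K(1)[OF c(1)]] .
  moreover have "\<not> lt' b (K c i)" for i
  proof
    assume "lt' b (K c i)"
    moreover have "K c i \<in> Y"
      using c(1) by (force simp: Y_def)
    then have "lt' (K c i) b" "K c i \<in> B"
      using b(2) YB by auto
    ultimately have "lt' b b"
      using dense_order_trans[OF B(1)] b(1) by metis
    then show False
      using dense_order_irrefl[OF B(1) b(1)] by simp
  qed
  ultimately show False
    using U by (simp add: eventually_False)
qed

theorem keisler_criterion_imp_continuum_hypothesis:
  assumes a: "continuum \<le>o |UNIV :: 'a set|" and b: "continuum \<le>o |UNIV :: 'b set|"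
    and K: "keisler_criterion TYPE('f) TYPE('r) TYPE('a) TYPE('b)"
  shows continuum_hypothesis
proof (rule ccontr)
  define w1 where "w1 = cardSuc natLeq"
  have w1: "Card_order w1" "infinite (Field w1)"
    unfolding w1_def
    using cardSuc_Card_order[OF natLeq_Card_order] cardSuc_finite[OF natLeq_Card_order]
    by (simp_all add: Field_natLeq)
  have cc: "Card_order continuum"
    by (rule Card_order_cexp)
  have "natLeq <o continuum"
    by (rule ordLess_ctwo_cexp[OF natLeq_Card_order])
  then have w1_le: "w1 \<le>o continuum"
    unfolding w1_def by (rule cardSuc_least[OF natLeq_Card_order cc])
  assume "\<not> continuum_hypothesis"
  then have "w1 <o continuum"
    using w1_le ordIso_symmetric
    unfolding continuum_hypothesis_def ordLeq_iff_ordLess_or_ordIso w1_def by blast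
  then have w2_le: "cardSuc w1 \<le>o continuum"
    by (rule cardSuc_least[OF w1(1) cc])
  have "infinite (Field natLeq)"
    by (simp add: Field_natLeq)
  then obtain A :: "'a set" and lt where A: "dense_order A lt" "|A| \<le>o w1"
    "\<And>X. X \<subseteq> A \<Longrightarrow> |X| \<le>o natLeq \<Longrightarrow> \<exists>c \<in> A. \<forall>x \<in> X. lt x c"
    using exists_dense_order[OF natLeq_Card_order _ ordLeq_transitive[OF w1_le[unfolded w1_def] a]]
    unfolding w1_def by metis
  obtain B :: "'b set" and lt' where B: "dense_order B lt'" "|B| \<le>o cardSuc w1"
    "\<And>Y. Y \<subseteq> B \<Longrightarrow> |Y| \<le>o w1 \<Longrightarrow> \<exists>c \<in> B. \<forall>y \<in> Y. lt' y c"
    using exists_dense_order[OF w1 ordLeq_transitive[OF w2_le b]] by metis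
  let ?L = "order_language undefined :: ('f, 'r) language"
  let ?M = "order_struct A lt :: ('f, 'r, 'a) struct"
  let ?N = "order_struct B lt' :: ('f, 'r, 'b) struct"
  have str: "structure_of ?L ?M" "structure_of ?L ?N"
    by (intro structure_of_order_struct dense_order_nonempty[OF A(1)] dense_order_nonempty[OF B(1)])+
  have card: "|universe ?M| \<le>o continuum" "|universe ?N| \<le>o continuum"
    using ordLeq_transitive[OF A(2) w1_le] ordLeq_transitive[OF B(2) w2_le] by simp_all
  have "\<exists>U :: nat filter. ultrafilter U \<and> isomorphic ?L (ultrapower ?M U) (ultrapower ?N U)"
    using K[unfolded keisler_criterion_def, rule_format, OF countable_order_language str card]
      elementarily_equivalent_dense_orders[OF A(1) B(1)] by (rule iffD1)
  then obtain U :: "nat filter" where U: "ultrafilter U"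
    "isomorphic ?L (ultrapower ?M U) (ultrapower ?N U)"
    by (elim exE conjE)
  have "U \<noteq> bot"
    using U(1) by (simp add: ultrafilter_def)
  from not_isomorphic_ultrapowers[OF this w1 A(2,3) B(1,3)] U(2) show False
    by (rule notE)
qed

theorem corollary2p5:
  assumes "infinite (UNIV :: 'f set)" and "infinite (UNIV :: 'r set)"
    and "continuum \<le>o |UNIV :: 'a set|" and "continuum \<le>o |UNIV :: 'b set|"
  shows "continuum_hypothesis \<longleftrightarrow>
    keisler_criterion TYPE('f) TYPE('r) TYPE('a) TYPE('b)"
  using continuum_hypothesis_imp_keisler_criterion
    keisler_criterion_imp_continuum_hypothesis[OF assms(3,4)] by (rule iffI)

end
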